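(* (a) Let $n\geq 5$. Then a red-blue graph $G$ is $(C_n,C_3)$-critical if and only if its blue subgraph is (isomorphic to) $K_{n-1,n-1}$ or $K_{n-1,n-1}-e$ for some edge $e$ of $K_{n-1,n-1}$. (b) Let $n\geq 6$. Then a red-blue graph $G$ is $(C_n,C_5)$-critical if and only if its blue subgraph is (isomorphic to) $K_{n-1,n-1}$ or $K_{n-1,n-1}-e$ for some edge $e$ of $K_{n-1,n-1}$.
   Context: All graphs are finite, simple and undirected; $C_k$ is the cycle of length $k$. A red-blue graph is a complete graph with each edge coloured red or blue; its blue subgraph is the uncoloured graph on the same vertex set whose edges are the blue edges. $R(C_n,C_k)$ is the least positive integer $N$ such that each red-blue graph on $N$ vertices contains a red $C_n$ or a blue $C_k$. A red-blue graph is $(C_n,C_k)$-critical if it has $R(C_n,C_k)-1$ vertices and contains neither a red $C_n$ nor a blue $C_k$. $K_{n-1,n-1}-e$ is $K_{n-1,n-1}$ with the edge $e$ deleted (vertices kept). *)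

theory Defs
  imports "HOL-Library.Ramsey"
begin

record 'a graph =
  verts :: "'a set"
  edges :: "'a set set"

definition simple_graph :: "'a graph \<Rightarrow> bool" where
  "simple_graph H \<longleftrightarrow> finite (verts H) \<and> edges H \<subseteq> nsets (verts H) 2"

definition graph_iso :: "'a graph \<Rightarrow> 'b graph \<Rightarrow> bool" where
  "graph_iso H K \<longleftrightarrow>
     (\<exists>f. bij_betw f (verts H) (verts K) \<and> edges K = (\<lambda>e. f ` e) ` edges H)"

text \<open>The graph \<open>H\<close> contains \<open>K\<close> as a (not necessarily induced) subgraph.\<close>

definition contains_graph :: "'a graph \<Rightarrow> 'b graph \<Rightarrow> bool" where
  "contains_graph H K \<longleftrightarrow>
     (\<exists>f. inj_on f (verts K) \<and> f ` verts K \<subseteq> verts H \<and> (\<lambda>e. f ` e) ` edges K \<subseteq> edges H)"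

text \<open>The cycle of length \<open>k\<close>; only meaningful for \<open>k \<ge> 3\<close>.\<close>

definition cycle_graph :: "nat \<Rightarrow> nat graph" where
  "cycle_graph k = \<lparr>verts = {..<k}, edges = {{i, Suc i mod k} |i. i < k}\<rparr>"

definition complete_bipartite :: "nat \<Rightarrow> nat \<Rightarrow> (nat + nat) graph" where
  "complete_bipartite a b =
     \<lparr>verts = {..<a} <+> {..<b}, edges = {{Inl i, Inr j} |i j. i < a \<and> j < b}\<rparr>"

definition delete_edge :: "'a graph \<Rightarrow> 'a set \<Rightarrow> 'a graph" where
  "delete_edge H e = \<lparr>verts = verts H, edges = edges H - {e}\<rparr>"

lemma simple_graph_cycle_graph: "3 \<le> k \<Longrightarrow> simple_graph (cycle_graph k)"
  by (auto simp: simple_graph_def cycle_graph_def nsets_def mod_Suc)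

lemma simple_graph_complete_bipartite: "simple_graph (complete_bipartite a b)"
  by (auto simp: simple_graph_def complete_bipartite_def nsets_def)

text \<open>A red-blue graph is the complete graph on a finite vertex set together with a colouring of
  its edges. The value of \<open>colouring\<close> at sets that are not two-element subsets of the vertex set
  is irrelevant.\<close>

datatype colour = Red | Blue

record 'a rb_graph =
  rb_verts :: "'a set"
  colouring :: "'a set \<Rightarrow> colour"

definition red_blue_graph :: "'a rb_graph \<Rightarrow> bool" where
  "red_blue_graph G \<longleftrightarrow> finite (rb_verts G)"

definition colour_subgraph :: "colour \<Rightarrow> 'a rb_graph \<Rightarrow> 'a graph" where
  "colour_subgraph c G =
     \<lparr>verts = rb_verts G, edges = {e \<in> nsets (rb_verts G) 2. colouring G e = c}\<rparr>"

abbreviation red_subgraph :: "'a rb_graph \<Rightarrow> 'a graph" where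
  "red_subgraph \<equiv> colour_subgraph Red"

abbreviation blue_subgraph :: "'a rb_graph \<Rightarrow> 'a graph" where
  "blue_subgraph \<equiv> colour_subgraph Blue"

lemma simple_graph_colour_subgraph: "red_blue_graph G \<Longrightarrow> simple_graph (colour_subgraph c G)"
  by (auto simp: simple_graph_def red_blue_graph_def colour_subgraph_def)

text \<open>Vertices range over \<open>nat\<close> here; since every finite set is in bijection with a set of natural
  numbers, this covers all red-blue graphs on \<open>N\<close> vertices up to isomorphism.\<close>

definition cycle_ramsey_number :: "nat \<Rightarrow> nat \<Rightarrow> nat" where
  "cycle_ramsey_number n k =
     (LEAST N. 0 < N \<and>
        (\<forall>G :: nat rb_graph. red_blue_graph G \<and> card (rb_verts G) = N \<longrightarrow>
           contains_graph (red_subgraph G) (cycle_graph n) \<or>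
           contains_graph (blue_subgraph G) (cycle_graph k)))"

definition cycle_critical :: "nat \<Rightarrow> nat \<Rightarrow> 'a rb_graph \<Rightarrow> bool" where
  "cycle_critical n k G \<longleftrightarrow>
     red_blue_graph G \<and>
     card (rb_verts G) = cycle_ramsey_number n k - 1 \<and>
     \<not> contains_graph (red_subgraph G) (cycle_graph n) \<and>
     \<not> contains_graph (blue_subgraph G) (cycle_graph k)"

end

theory Submission
  imports Defs
begin

text \<open>Let a red-blue graph contain a red cycle \<open>C\<close> of length \<open>n - 1\<close> but no red \<open>C\<^sub>n\<close>. If a vertex
  outside \<open>C\<close> is red to two vertices of \<open>C\<close>, then their successors on \<open>C\<close> are joined by a blue edge,
  and so are their predecessors. Without a blue \<open>C\<^sub>3\<close> or \<open>C\<^sub>5\<close> this leaves so few red edges between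
  \<open>C\<close> and the remaining vertices that a blue edge among the latter would close a short blue odd
  cycle; hence they form a red clique. Starting from a red \<open>C\<^sub>3\<close> or \<open>C\<^sub>5\<close>, this yields by
  induction a red \<open>C\<^sub>m\<close> in every graph on at least \<open>2 m\<close> vertices without the blue cycle. In a critical
  graph the \<open>n - 1\<close> vertices outside a red \<open>C\<^bsub>n-1\<^esub>\<close> form a red clique, which contains another red
  \<open>C\<^bsub>n-1\<^esub>\<close>, so the vertices of \<open>C\<close> form a red clique as well; two red edges between the two cliques
  would give a red \<open>C\<^sub>n\<close>.\<close>

section \<open>Cycles as lists\<close>

text \<open>Cycles are taken over a bare relation so that the same lemmas serve red
  (\<open>R\<close>) and blue (its negation). Distinctness makes the values on the diagonal
  irrelevant once the length is at least 2.\<close>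

definition cycle_list :: "('a \<Rightarrow> 'a \<Rightarrow> bool) \<Rightarrow> 'a list \<Rightarrow> bool" where
  "cycle_list E xs \<longleftrightarrow> xs \<noteq> [] \<and> distinct xs \<and> successively E xs \<and> E (last xs) (hd xs)"

definition has_cycle :: "('a \<Rightarrow> 'a \<Rightarrow> bool) \<Rightarrow> 'a set \<Rightarrow> nat \<Rightarrow> bool" where
  "has_cycle E V k \<longleftrightarrow> (\<exists>xs. cycle_list E xs \<and> length xs = k \<and> set xs \<subseteq> V)"

lemma has_cycleI: "cycle_list E xs \<Longrightarrow> length xs = k \<Longrightarrow> set xs \<subseteq> V \<Longrightarrow> has_cycle E V k"
  by (auto simp: has_cycle_def)

lemma has_cycle_mono: "has_cycle E V k \<Longrightarrow> V \<subseteq> W \<Longrightarrow> has_cycle E W k"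
  by (auto simp: has_cycle_def)

lemma cycle_list_conv_nth:
  "cycle_list E xs \<longleftrightarrow> xs \<noteq> [] \<and> distinct xs \<and>
     (\<forall>i<length xs. E (xs ! i) (xs ! (Suc i mod length xs)))"
proof (cases "xs = []")
  case False
  have "(\<forall>i<length xs. E (xs ! i) (xs ! (Suc i mod length xs))) \<longleftrightarrow>
      successively E xs \<and> E (last xs) (hd xs)" (is "?L \<longleftrightarrow> ?R")
  proof
    assume L: ?L
    have "E (xs ! i) (xs ! Suc i)" if "Suc i < length xs" for i
      using L[rule_format, of i] that by simp
    moreover have "E (last xs) (hd xs)"
      using L[rule_format, of "length xs - 1"] False by (simp add: last_conv_nth hd_conv_nth)
    ultimately show ?R by (simp add: successively_conv_nth)
  next
    assume R: ?R
    show ?L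
    proof (intro allI impI)
      fix i assume "i < length xs"
      show "E (xs ! i) (xs ! (Suc i mod length xs))"
      proof (cases "Suc i < length xs")
        case True
        then show ?thesis using R by (simp add: successively_conv_nth)
      next
        case c: False
        then have "i = length xs - 1" "Suc i = length xs" using \<open>i < length xs\<close> by auto
        then show ?thesis using R False by (simp add: last_conv_nth hd_conv_nth)
      qed
    qed
  qed
  then show ?thesis by (auto simp: cycle_list_def)
qed (simp add: cycle_list_def)

lemma cycle_list_rotate:
  assumes "cycle_list E xs" shows "cycle_list E (rotate n xs)"
proof (induction n)
  case (Suc n)
  then obtain y ys where "rotate n xs = y # ys" "cycle_list E (y # ys)"
    by (cases "rotate n xs") (auto simp: cycle_list_def)
  then show ?case
    by (auto simp: cycle_list_def successively_append_iff successively_Cons split: if_splits)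
qed (use assms in simp)

lemma successively_rev_symp:
  assumes "symp E" shows "successively E (rev xs) \<longleftrightarrow> successively E xs"
  unfolding successively_rev
  by (rule successively_cong) (use assms in \<open>auto dest: sympD\<close>)

lemma cycle_list_rev:
  assumes "symp E" "cycle_list E xs" shows "cycle_list E (rev xs)"
proof -
  have "successively E (rev xs)"
    using assms by (simp add: successively_rev_symp cycle_list_def del: successively_rev)
  then show ?thesis using assms
    by (auto simp: cycle_list_def hd_rev last_rev simp del: successively_rev dest: sympD)
qed

text \<open>Read cyclically, \<open>x\<close> is followed by \<open>hd (as @ [y])\<close> and
  \<open>y\<close> by \<open>hd (bs @ [x])\<close>. The edges leaving \<open>x\<close> and
  \<open>y\<close> are replaced by the detour \<open>y, w, x\<close> and by the chord between the
  two successors; the segment \<open>bs\<close> is then traversed backwards.\<close>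

lemma cycle_list_insert:
  assumes "symp E" "cycle_list E (as @ y # bs @ [x])" "w \<notin> set (as @ y # bs @ [x])"
    and "E w x" "E w y" "E (hd (as @ [y])) (hd (bs @ [x]))"
  shows "cycle_list E (as @ [y, w, x] @ rev bs)"
proof -
  have d: "distinct (as @ [y, w, x] @ rev bs)"
    using assms(2,3) by (auto simp: cycle_list_def)
  have sym: "E a b \<longleftrightarrow> E b a" for a b using assms(1) by (auto dest: sympD)
  have c: "successively E as" "as \<noteq> [] \<longrightarrow> E (last as) y" "successively E bs"
    "bs \<noteq> [] \<longrightarrow> E (last bs) x"
    using assms(2) by (auto simp: cycle_list_def successively_append_iff successively_Cons split: if_splits)
  have "successively E (rev bs)" using c assms(1) by (simp add: successively_rev_symp del: successively_rev)
  moreover have "bs \<noteq> [] \<longrightarrow> E x (hd (rev bs))" using c sym by (simp add: hd_rev)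
  moreover have "E y w" "E w x" using assms(4,5) sym by blast+
  ultimately have "successively E (as @ [y, w, x] @ rev bs)"
    using c by (auto simp add: successively_append_iff successively_Cons simp del: successively_rev)
  moreover have "E (last (as @ [y, w, x] @ rev bs)) (hd (as @ [y, w, x] @ rev bs))"
  proof -
    have "last (as @ [y, w, x] @ rev bs) = hd (bs @ [x])" by (cases bs) auto
    moreover have "hd (as @ [y, w, x] @ rev bs) = hd (as @ [y])" by (cases as) auto
    ultimately show ?thesis using assms(6) sym by metis
  qed
  ultimately show ?thesis using d by (simp add: cycle_list_def)
qed

text \<open>Rotating \<open>xs ! i\<close> to the last position brings the cycle into the shape
  required by \<open>cycle_list_insert\<close>.\<close>

lemma cycle_extend_nth:
  assumes sym: "symp E" and cyc: "cycle_list E xs" and m: "m = length xs"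
    and i: "i < m" and j: "j < m" and "i \<noteq> j" and w: "w \<notin> set xs"
    and "E w (xs ! i)" "E w (xs ! j)" "E (xs ! (Suc i mod m)) (xs ! (Suc j mod m))"
  shows "has_cycle E (insert w (set xs)) (Suc m)"
proof -
  define zs where "zs = rotate (Suc i) xs"
  \<comment> \<open>The position of \<open>xs ! j\<close> after the rotation; adding
    \<open>m\<close> keeps the subtraction from truncating.\<close>
  define k where "k = (j + m - Suc i) mod m"
  have len: "length zs = m" by (simp add: zs_def m)
  have czs: "cycle_list E zs" unfolding zs_def by (rule cycle_list_rotate[OF cyc])
  have nth: "zs ! l = xs ! ((Suc i + l) mod m)" if "l < m" for l
    using that unfolding zs_def m by (subst nth_rotate) (auto)
  have km: "k < m" using i by (simp add: k_def)
  have kj: "(Suc i + k) mod m = j"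
  proof -
    have "(Suc i + k) mod m = (Suc i + (j + m - Suc i)) mod m" unfolding k_def by (rule mod_add_right_eq)
    also have "Suc i + (j + m - Suc i) = j + m" using i by simp
    finally show ?thesis using j by simp
  qed
  have k1: "Suc k < m"
  proof (rule ccontr)
    assume "\<not> Suc k < m"
    then have "Suc i + k = i + m" using km by simp
    then have "(Suc i + k) mod m = i" using i by (metis mod_add_self2 mod_less)
    then show False using kj \<open>i \<noteq> j\<close> by simp
  qed
  have lastzs: "last zs = xs ! i"
  proof -
    have "zs \<noteq> []" using czs by (simp add: cycle_list_def)
    then have "last zs = zs ! (m - 1)" by (simp add: last_conv_nth len)
    also have "\<dots> = xs ! ((Suc i + (m - 1)) mod m)" using i by (subst nth) auto
    also have "Suc i + (m - 1) = i + m" using i by simp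
    finally show ?thesis using i by simp
  qed
  define bs where "bs = butlast (drop (Suc k) zs)"
  have bs: "drop (Suc k) zs = bs @ [xs ! i]"
    using append_butlast_last_id[of "drop (Suc k) zs"] k1 len lastzs by (simp add: bs_def)
  have zk: "zs ! k = xs ! j" using nth[OF km] kj by simp
  have zs: "zs = take k zs @ xs ! j # bs @ [xs ! i]"
    using id_take_nth_drop[of k zs] km len zk bs by simp
  have "hd (take k zs @ [xs ! j]) = hd zs"
    by (subst (2) zs) (simp add: hd_append)
  also have "\<dots> = zs ! 0" using czs by (simp add: cycle_list_def hd_conv_nth)
  also have "\<dots> = xs ! (Suc i mod m)" using nth[of 0] i by simp
  finally have h1: "hd (take k zs @ [xs ! j]) = xs ! (Suc i mod m)" .
  have "hd (bs @ [xs ! i]) = zs ! Suc k"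
    using bs k1 len by (metis hd_drop_conv_nth)
  also have "\<dots> = xs ! (Suc j mod m)"
    using nth[OF k1] kj by (metis add_Suc_right mod_Suc_eq)
  finally have h2: "hd (bs @ [xs ! i]) = xs ! (Suc j mod m)" .
  have set: "set (take k zs @ xs ! j # bs @ [xs ! i]) = set xs"
    using arg_cong[OF zs, of set] by (simp add: zs_def)
  let ?ys = "take k zs @ [xs ! j, w, xs ! i] @ rev bs"
  have "cycle_list E ?ys"
  proof (rule cycle_list_insert[OF sym])
    show "cycle_list E (take k zs @ xs ! j # bs @ [xs ! i])" using czs zs by simp
    show "w \<notin> set (take k zs @ xs ! j # bs @ [xs ! i])" using w set by simp
  qed (use assms h1 h2 in auto)
  moreover have "length ?ys = Suc m"
    using arg_cong[OF zs, of length] len by simp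
  moreover have "set ?ys \<subseteq> insert w (set xs)" using set by auto
  ultimately show ?thesis by (rule has_cycleI)
qed

text \<open>\<open>s\<close> and \<open>p\<close> are the successor and predecessor maps along the
  cycle. The non-adjacency facts are the contrapositive of \<open>cycle_extend_nth\<close>, packaged
  so that later arguments avoid index arithmetic.\<close>

lemma cycle_successor:
  assumes sym: "symp E" and cyc: "cycle_list E xs" and m: "m = length xs" "3 \<le> m"
    and V: "set xs \<subseteq> V" and no: "\<not> has_cycle E V (Suc m)"
  obtains s p where
    "\<And>x. x \<in> set xs \<Longrightarrow> s x \<in> set xs" "\<And>x. x \<in> set xs \<Longrightarrow> p x \<in> set xs"
    "\<And>x. x \<in> set xs \<Longrightarrow> s (p x) = x" "\<And>x. x \<in> set xs \<Longrightarrow> p (s x) = x"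
    "\<And>x. x \<in> set xs \<Longrightarrow> s (s x) \<noteq> x"
    "\<And>x. x \<in> set xs \<Longrightarrow> 5 \<le> m \<Longrightarrow> s (s (s (s x))) \<noteq> x"
    "\<And>w x y. w \<in> V - set xs \<Longrightarrow> x \<in> set xs \<Longrightarrow> y \<in> set xs \<Longrightarrow> x \<noteq> y \<Longrightarrow> E w x \<Longrightarrow> E w y \<Longrightarrow>
       \<not> E (s x) (s y) \<and> \<not> E (p x) (p y)"
    "\<And>w x. w \<in> V - set xs \<Longrightarrow> x \<in> set xs \<Longrightarrow> E w x \<Longrightarrow> \<not> E w (s x) \<and> \<not> E w (p x)"
proof -
  have d: "distinct xs" using cyc by (simp add: cycle_list_def)
  define ix where "ix x = (THE i. i < m \<and> xs ! i = x)" for x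
  have ix: "ix (xs ! i) = i" if "i < m" for i
    unfolding ix_def using that d m by (auto simp: nth_eq_iff_index_eq)
  have ex: "\<exists>i<m. x = xs ! i" if "x \<in> set xs" for x
    using that m by (auto simp: in_set_conv_nth)
  define s where "s x = xs ! (Suc (ix x) mod m)" for x
  \<comment> \<open>Adding \<open>m\<close> before subtracting 1 lets index 0 wrap round to
    \<open>m - 1\<close>.\<close>
  define p where "p x = xs ! ((ix x + m - 1) mod m)" for x
  have m0: "0 < m" using m(2) by simp
  have s: "s (xs ! i) = xs ! (Suc i mod m)" if "i < m" for i using ix that by (simp add: s_def)
  have p: "p (xs ! i) = xs ! ((i + m - 1) mod m)" if "i < m" for i using ix that by (simp add: p_def)
  have eq: "xs ! i = xs ! j \<longleftrightarrow> i = j" if "i < m" "j < m" for i j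
    using that d m by (simp add: nth_eq_iff_index_eq)
  have 1: "s x \<in> set xs" "p x \<in> set xs" for x
    using m0 unfolding s_def p_def m(1) by (meson mod_less_divisor nth_mem)+
  have sp: "s (p x) = x" if x: "x \<in> set xs" for x
  proof -
    obtain i where i: "i < m" "x = xs ! i" using ex[OF x] by blast
    have "Suc ((i + m - 1) mod m) mod m = (Suc (i + m - 1)) mod m" by (simp add: mod_Suc_eq)
    also have "\<dots> = i" using i by simp
    finally show ?thesis using i m0 by (simp add: p s)
  qed
  have ps: "p (s x) = x" if x: "x \<in> set xs" for x
  proof -
    obtain i where i: "i < m" "x = xs ! i" using ex[OF x] by blast
    have "(Suc i mod m + m - 1) mod m = i"
      using i by (cases "Suc i = m") auto
    then show ?thesis using i m0 by (simp add: p s)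
  qed
  have ss: "s (s x) \<noteq> x" if x: "x \<in> set xs" for x
  proof -
    obtain i where i: "i < m" "x = xs ! i" using ex[OF x] by blast
    have "Suc (Suc i mod m) mod m = (i + 2) mod m" by (simp add: mod_Suc_eq)
    also have "\<dots> \<noteq> i"
    proof
      assume a: "(i + 2) mod m = i"
      have "\<not> i + 2 < m" using a by auto
      then have "(i + 2) mod m = i + 2 - m" using i x m by (simp add: le_mod_geq)
      then show False using a i x m \<open>\<not> i + 2 < m\<close> by linarith
    qed
    finally show ?thesis using i m0 by (simp add: s eq)
  qed
  have ssss: "s (s (s (s x))) \<noteq> x" if x: "x \<in> set xs" "5 \<le> m" for x
  proof -
    obtain i where i: "i < m" "x = xs ! i" using ex[OF x(1)] by blast
    have "Suc (Suc (Suc (Suc i mod m) mod m) mod m) mod m = (i + 4) mod m"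
      by (simp add: mod_Suc_eq eval_nat_numeral)
    also have "\<dots> \<noteq> i"
    proof
      assume a: "(i + 4) mod m = i"
      have "\<not> i + 4 < m" using a by auto
      then have "(i + 4) mod m = i + 4 - m" using i x m by (simp add: le_mod_geq)
      then show False using a i x m \<open>\<not> i + 4 < m\<close> by linarith
    qed
    finally show ?thesis using i m0 by (simp add: s eq)
  qed
  have sxy: "\<not> E (s x) (s y)"
    if h: "w \<in> V - set xs" "x \<in> set xs" "y \<in> set xs" "x \<noteq> y" "E w x" "E w y" for w x y
  proof
    assume a: "E (s x) (s y)"
    obtain i where i: "i < m" "x = xs ! i" using ex h(2) by blast
    obtain j where j: "j < m" "y = xs ! j" using ex h(3) by blast
    have "has_cycle E (insert w (set xs)) (Suc m)"
      by (rule cycle_extend_nth[OF sym cyc m(1) i(1) j(1)]) (use h i j a in \<open>auto simp: s\<close>)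
    moreover have "insert w (set xs) \<subseteq> V" using h V by auto
    ultimately show False using no has_cycle_mono by blast
  qed
  have pxy: "\<not> E (p x) (p y)"
    if h: "w \<in> V - set xs" "x \<in> set xs" "y \<in> set xs" "x \<noteq> y" "E w x" "E w y" for w x y
  proof
    assume a: "E (p x) (p y)"
    obtain i where i: "i < m" "x = xs ! i" using ex h(2) by blast
    obtain j where j: "j < m" "y = xs ! j" using ex h(3) by blast
    \<comment> \<open>Predecessors are successors on the reversed cycle, where the vertex of index
      \<open>i\<close> has index \<open>m - 1 - i\<close>.\<close>
    have r: "rev xs ! (m - 1 - i) = xs ! i" if "i < m" for i using that m by (simp add: rev_nth)
    have rp: "rev xs ! (Suc (m - 1 - i) mod m) = p (xs ! i)" if "i < m" for i
    proof (cases i)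
      case 0
      then have "Suc (m - 1 - i) mod m = 0" "(i + m - 1) mod m = m - 1" using m0 by auto
      moreover have "rev xs ! 0 = xs ! (m - 1)"
        using m0 rev_nth[of 0 xs] m(1) by simp
      ultimately show ?thesis using p[OF that] by simp
    next
      case (Suc k)
      then have "Suc (m - 1 - i) mod m = m - 1 - k" "(i + m - 1) mod m = k" using that by auto
      then show ?thesis using that Suc m by (simp add: p rev_nth)
    qed
    have mi: "m - 1 - i < m" "m - 1 - j < m" using m0 by auto
    have "has_cycle E (insert w (set (rev xs))) (Suc m)"
    proof (rule cycle_extend_nth[OF sym cycle_list_rev[OF sym cyc] _ mi])
      have "i \<noteq> j" using h(4) i(2) j(2) by blast
      then show "m - 1 - i \<noteq> m - 1 - j" using i(1) j(1) by arith
      show "E w (rev xs ! (m - 1 - i))" "E w (rev xs ! (m - 1 - j))"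
        unfolding r[OF i(1)] r[OF j(1)] using h i(2) j(2) by blast+
      show "E (rev xs ! (Suc (m - 1 - i) mod m)) (rev xs ! (Suc (m - 1 - j) mod m))"
        unfolding rp[OF i(1)] rp[OF j(1)] using a i(2) j(2) by blast
    qed (use m h in auto)
    moreover have "insert w (set xs) \<subseteq> V" using h V by auto
    ultimately show False using no has_cycle_mono by fastforce
  qed
  have edge: "E x (s x)" if x: "x \<in> set xs" for x
  proof -
    obtain i where i: "i < m" "x = xs ! i" using ex[OF x] by blast
    then show ?thesis using cyc m by (simp add: cycle_list_conv_nth s)
  qed
  have sne: "s x \<noteq> x" if "x \<in> set xs" for x using ss[OF that] by metis
  \<comment> \<open>If \<open>w\<close> were adjacent to \<open>x\<close> and \<open>s x\<close>,
    then \<open>s x\<close> and \<open>s (s x)\<close> would be non-adjacent by \<open>sxy\<close>,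
    although they are consecutive on the cycle.\<close>
  have ws: "\<not> E w (s x)" if h: "w \<in> V - set xs" "x \<in> set xs" "E w x" for w x
    using sxy[OF h(1) h(2) 1(1)[of x]] edge[OF 1(1)[of x]] sne[OF h(2)] h(3) by metis
  have wp: "\<not> E w (p x)" if h: "w \<in> V - set xs" "x \<in> set xs" "E w x" for w x
    using ws[OF h(1) 1(2)[of x]] sp[OF h(2)] h(3) by metis
  show ?thesis
  proof (rule that[of s p])
    show "\<not> E (s x) (s y) \<and> \<not> E (p x) (p y)"
      if "w \<in> V - set xs" "x \<in> set xs" "y \<in> set xs" "x \<noteq> y" "E w x" "E w y" for w x y
      using sxy[OF that] pxy[OF that] by blast
    show "\<not> E w (s x) \<and> \<not> E w (p x)" if "w \<in> V - set xs" "x \<in> set xs" "E w x" for w x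
      using ws[OF that] wp[OF that] by blast
  qed (rule 1 sp ps ss ssss; assumption)+
qed

section \<open>Cliques and explicit short cycles\<close>

definition clique_in :: "('a \<Rightarrow> 'a \<Rightarrow> bool) \<Rightarrow> 'a set \<Rightarrow> bool" where
  "clique_in E S \<longleftrightarrow> (\<forall>x\<in>S. \<forall>y\<in>S. x \<noteq> y \<longrightarrow> E x y)"

lemma has_cycle_3:
  assumes "E a b" "E b c" "E c a" "distinct [a, b, c]" "{a, b, c} \<subseteq> V"
  shows "has_cycle E V 3"
  by (rule has_cycleI[of _ "[a, b, c]"]) (use assms in \<open>auto simp: cycle_list_def\<close>)

lemma has_cycle_4:
  assumes "E a b" "E b c" "E c d" "E d a" "distinct [a, b, c, d]" "{a, b, c, d} \<subseteq> V"
  shows "has_cycle E V 4"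
  by (rule has_cycleI[of _ "[a, b, c, d]"]) (use assms in \<open>auto simp: cycle_list_def\<close>)

lemma has_cycle_5:
  assumes "E a b" "E b c" "E c d" "E d e" "E e a" "distinct [a, b, c, d, e]"
    "{a, b, c, d, e} \<subseteq> V"
  shows "has_cycle E V 5"
  by (rule has_cycleI[of _ "[a, b, c, d, e]"]) (use assms in \<open>auto simp: cycle_list_def\<close>)

lemma has_cycle_4E:
  assumes "has_cycle E V 4"
  obtains a b c d where "E a b" "E b c" "E c d" "E d a" "distinct [a, b, c, d]" "{a, b, c, d} \<subseteq> V"
proof -
  obtain xs where xs: "cycle_list E xs" "length xs = 4" "set xs \<subseteq> V"
    using assms by (auto simp: has_cycle_def)
  then obtain a b c d where "xs = [a, b, c, d]"
    by (auto simp: numeral_eq_Suc length_Suc_conv)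
  then show ?thesis using xs that[of a b c d] by (auto simp: cycle_list_def)
qed

text \<open>The prescribed ends allow the path to be closed up through vertices outside the
  clique.\<close>

lemma clique_in_path:
  assumes S: "clique_in E S" "finite S" and uv: "u \<in> S" "v \<in> S" "u \<noteq> v"
    and q: "2 \<le> q" "q \<le> card S"
  obtains xs where "distinct xs" "length xs = q" "set xs \<subseteq> S" "hd xs = u" "last xs = v"
    "successively E xs"
proof -
  have "q - 2 \<le> card (S - {u, v})" using S uv q by (simp add: card_Diff_subset)
  then obtain T where T: "T \<subseteq> S - {u, v}" "card T = q - 2" "finite T"
    using S(2) by (meson finite_Diff obtain_subset_with_card_n)
  obtain ts where ts: "set ts = T" "distinct ts" using finite_distinct_list[OF T(3)] by blast
  let ?xs = "u # ts @ [v]"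
  have d: "distinct ?xs" using ts T uv by auto
  have sub: "set ?xs \<subseteq> S" using ts T uv by auto
  have "successively E xs" if "distinct xs" "set xs \<subseteq> S" for xs
    using that
  proof (induction xs rule: induct_list012)
    case (3 x y zs)
    then show ?case using S(1) by (auto simp: clique_in_def)
  qed auto
  then have "successively E ?xs" using d sub by blast
  moreover have "length ?xs = q"
    using ts T q distinct_card[of ts] by simp
  ultimately show ?thesis using that[of ?xs] d sub by simp
qed

lemma clique_in_cycle:
  assumes S: "clique_in E S" "finite S" and q: "2 \<le> q" "q \<le> card S"
  shows "has_cycle E S q"
proof -
  have "\<exists>u v. u \<in> S \<and> v \<in> S \<and> u \<noteq> v"
  proof (rule ccontr)
    assume "\<not> ?thesis"
    then have "card S \<le> 1" using S(2) by (auto simp: card_le_Suc0_iff_eq)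
    then show False using q by simp
  qed
  then obtain u v where uv: "u \<in> S" "v \<in> S" "u \<noteq> v" by blast
  obtain xs where xs: "distinct xs" "length xs = q" "set xs \<subseteq> S" "hd xs = u" "last xs = v"
    "successively E xs"
    using clique_in_path[OF S uv q] by blast
  have "E v u" using S(1) uv by (auto simp: clique_in_def)
  then show ?thesis using xs q by (intro has_cycleI[of _ xs]) (auto simp: cycle_list_def)
qed

section \<open>Vertices outside a red cycle\<close>

text \<open>If an outside vertex \<open>w\<close> had two red neighbours \<open>x\<close>,
  \<open>y\<close> on the cycle, then \<open>w\<close>, \<open>s x\<close>, \<open>s y\<close> would
  be a blue triangle. With at most one red neighbour each, two outside vertices have a common blue
  neighbour on the cycle, so a blue edge between them would close a triangle.\<close>

lemma clique_outside_cycle_3: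
  assumes sym: "symp R" and V: "finite V" and cyc: "cycle_list R xs" "length xs = m" "set xs \<subseteq> V"
    and m: "3 \<le> m" and noR: "\<not> has_cycle R V (Suc m)"
    and noB: "\<not> has_cycle (\<lambda>x y. \<not> R x y) V 3"
  shows "clique_in R (V - set xs)"
proof -
  let ?C = "set xs"
  have comm: "R a b \<longleftrightarrow> R b a" for a b using sym by (auto dest: sympD)
  obtain s p where sC: "\<And>x. x \<in> ?C \<Longrightarrow> s x \<in> ?C" and "\<And>x. x \<in> ?C \<Longrightarrow> p x \<in> ?C"
    and "\<And>x. x \<in> ?C \<Longrightarrow> s (p x) = x" and ps: "\<And>x. x \<in> ?C \<Longrightarrow> p (s x) = x"
    and "\<And>x. x \<in> ?C \<Longrightarrow> s (s x) \<noteq> x" and "\<And>x. x \<in> ?C \<Longrightarrow> 5 \<le> m \<Longrightarrow> s (s (s (s x))) \<noteq> x"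
    and two: "\<And>w x y. w \<in> V - ?C \<Longrightarrow> x \<in> ?C \<Longrightarrow> y \<in> ?C \<Longrightarrow> x \<noteq> y \<Longrightarrow> R w x \<Longrightarrow> R w y \<Longrightarrow>
       \<not> R (s x) (s y) \<and> \<not> R (p x) (p y)"
    and nxt: "\<And>w x. w \<in> V - ?C \<Longrightarrow> x \<in> ?C \<Longrightarrow> R w x \<Longrightarrow> \<not> R w (s x) \<and> \<not> R w (p x)"
    by (rule cycle_successor[OF sym cyc(1) cyc(2)[symmetric] m cyc(3) noR]) blast
  have one: "card {x \<in> ?C. R w x} \<le> 1" if w: "w \<in> V - ?C" for w
  proof -
    have "x = y" if h: "x \<in> ?C" "y \<in> ?C" "R w x" "R w y" for x y
    proof (rule ccontr)
      assume "x \<noteq> y"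
      have "s x \<noteq> s y" using \<open>x \<noteq> y\<close> ps[OF h(1)] ps[OF h(2)] by metis
      moreover have "\<not> R w (s x)" "\<not> R (s x) (s y)" "\<not> R (s y) w"
        using two[OF w h(1,2) \<open>x \<noteq> y\<close> h(3,4)] nxt[OF w h(1,3)] nxt[OF w h(2,4)] comm by auto
      ultimately have "has_cycle (\<lambda>x y. \<not> R x y) V 3"
        using w sC[OF h(1)] sC[OF h(2)] cyc(3) by (intro has_cycle_3[of _ w "s x" "s y"]) auto
      then show False using noB by blast
    qed
    then show ?thesis by (auto simp: card_le_Suc0_iff_eq)
  qed
  show ?thesis unfolding clique_in_def
  proof (intro ballI impI, rule ccontr)
    fix v w assume vw: "v \<in> V - ?C" "w \<in> V - ?C" "v \<noteq> w" "\<not> R v w"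
    let ?X = "{x \<in> ?C. R v x} \<union> {x \<in> ?C. R w x}"
    have "card ?X \<le> 1 + 1"
      using one[OF vw(1)] one[OF vw(2)] card_Un_le[of "{x \<in> ?C. R v x}" "{x \<in> ?C. R w x}"] by linarith
    moreover have "card ?C = m" using cyc by (simp add: cycle_list_def distinct_card)
    ultimately have "\<not> ?C \<subseteq> ?X" using m card_mono[of ?X ?C] by auto
    then obtain c where "c \<in> ?C" "\<not> R v c" "\<not> R w c" by blast
    then have "has_cycle (\<lambda>x y. \<not> R x y) V 3"
      using vw cyc(3) comm by (intro has_cycle_3[of _ v w c]) auto
    then show False using noB by blast
  qed
qed

text \<open>Two outside vertices share at most one red neighbour on the cycle
  (\<open>share\<close>), and each has at most two (\<open>three\<close>). With a third outside
  vertex \<open>u\<close>, a blue edge \<open>v w\<close> then closes to a blue cycle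
  \<open>v, c, u, d, w\<close>.\<close>

lemma clique_outside_cycle_5:
  assumes sym: "symp R" and V: "finite V" and cyc: "cycle_list R xs" "length xs = m" "set xs \<subseteq> V"
    and m: "5 \<le> m" and W: "5 \<le> card (V - set xs)" and noR: "\<not> has_cycle R V (Suc m)"
    and noB: "\<not> has_cycle (\<lambda>x y. \<not> R x y) V 5"
  shows "clique_in R (V - set xs)"
proof -
  let ?C = "set xs" and ?W = "V - set xs"
  have comm: "R a b \<longleftrightarrow> R b a" for a b using sym by (auto dest: sympD)
  have m3: "3 \<le> m" using m by simp
  have cardC: "card ?C = m" using cyc by (simp add: cycle_list_def distinct_card)
  have no5: False if "\<not> R a b" "\<not> R b c" "\<not> R c d" "\<not> R d e" "\<not> R e a" "distinct [a, b, c, d, e]"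
    "{a, b, c, d, e} \<subseteq> V" for a b c d e
    using has_cycle_5[of "\<lambda>x y. \<not> R x y" a b c d e V] that noB by simp
  obtain s p where sC: "\<And>x. x \<in> ?C \<Longrightarrow> s x \<in> ?C" and pC: "\<And>x. x \<in> ?C \<Longrightarrow> p x \<in> ?C"
    and sp: "\<And>x. x \<in> ?C \<Longrightarrow> s (p x) = x" and ps: "\<And>x. x \<in> ?C \<Longrightarrow> p (s x) = x"
    and ss: "\<And>x. x \<in> ?C \<Longrightarrow> s (s x) \<noteq> x"
    and ssss: "\<And>x. x \<in> ?C \<Longrightarrow> 5 \<le> m \<Longrightarrow> s (s (s (s x))) \<noteq> x"
    and two: "\<And>w x y. w \<in> ?W \<Longrightarrow> x \<in> ?C \<Longrightarrow> y \<in> ?C \<Longrightarrow> x \<noteq> y \<Longrightarrow> R w x \<Longrightarrow> R w y \<Longrightarrow>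
       \<not> R (s x) (s y) \<and> \<not> R (p x) (p y)"
    and nxt: "\<And>w x. w \<in> ?W \<Longrightarrow> x \<in> ?C \<Longrightarrow> R w x \<Longrightarrow> \<not> R w (s x) \<and> \<not> R w (p x)"
    by (rule cycle_successor[OF sym cyc(1) cyc(2)[symmetric] m3 cyc(3) noR]) blast
  have s_inj: "s x = s y \<longleftrightarrow> x = y" if "x \<in> ?C" "y \<in> ?C" for x y using that ps by metis
  have share: "w = w'" if h: "w \<in> ?W" "w' \<in> ?W" "x \<in> ?C" "y \<in> ?C" "x \<noteq> y"
      "R w x" "R w y" "R w' x" "R w' y" for w w' x y
  proof (rule ccontr)
    assume ne: "w \<noteq> w'"
    \<comment> \<open>The blue cycle will be \<open>w, s x, s y, w', z\<close>; only on a cycle of length 4 could both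
      predecessors already be used.\<close>
    have "\<exists>z\<in>{p x, p y}. z \<notin> {s x, s y}"
    proof (rule ccontr)
      assume "\<not> ?thesis"
      moreover have "p x \<noteq> s x" "p y \<noteq> s y" using ss sp pC h by metis+
      ultimately have "p x = s y" "p y = s x" by auto
      then have "x = s (s y)" "y = s (s x)" using sp h by metis+
      then show False using ssss[OF h(3) m] by simp
    qed
    then obtain z where z: "z \<in> {p x, p y}" "z \<notin> {s x, s y}" by blast
    have zC: "z \<in> ?C" using z pC h by auto
    have zw: "\<not> R w' z" "\<not> R z w" using z nxt h comm by auto
    have "\<not> R w (s x)" "\<not> R (s x) (s y)" "\<not> R (s y) w'" using two nxt h comm by blast+
    then show False
      by (rule no5[of w "s x" "s y" w' z]) (use zw z zC h sC[OF h(3)] sC[OF h(4)] s_inj[OF h(3,4)] ne cyc(3) in auto)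
  qed
  have three: False if h: "w \<in> ?W" "x \<in> ?C" "y \<in> ?C" "z \<in> ?C" "x \<noteq> y" "x \<noteq> z" "y \<noteq> z"
    "R w x" "R w y" "R w z" for w x y z
  proof -
    have sin: "s x \<in> ?C" "s y \<in> ?C" "s z \<in> ?C" using sC h by auto
    have sne: "s x \<noteq> s y" "s x \<noteq> s z" "s y \<noteq> s z" using s_inj h by auto
    have k4: "\<not> R w (s x)" "\<not> R w (s y)" "\<not> R w (s z)" "\<not> R (s x) (s y)" "\<not> R (s x) (s z)"
      "\<not> R (s y) (s z)" using h two[OF h(1)] nxt[OF h(1)] by auto
    \<comment> \<open>As \<open>w, s x, s y, s z\<close> form a blue \<open>K\<^sub>4\<close>, any other vertex has at most one blue neighbour
      in it, so by pigeonhole two of the vertices outside the cycle share two red neighbours.\<close>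
    have most: "R w' a \<or> R w' b"
      if "w' \<in> ?W - {w}" "{a, b, c} = {s x, s y, s z}" "distinct [a, b, c]" for w' a b c
    proof (rule ccontr)
      assume n: "\<not> ?thesis"
      have abc: "a \<in> {s x, s y, s z}" "b \<in> {s x, s y, s z}" "c \<in> {s x, s y, s z}"
        using that(2) by auto
      have "\<not> R a c" "\<not> R c w" "\<not> R w b" using abc k4 that(3) comm by auto
      moreover have "a \<in> ?C" "b \<in> ?C" "c \<in> ?C" using abc sin by auto
      ultimately show False
        by (intro no5[of w' a c w b]) (use n that(1,3) comm h(1) cyc(3) in auto)
    qed
    let ?P = "\<lambda>a b. {v \<in> ?W - {w}. R v a \<and> R v b}"
    have le1: "card (?P a b) \<le> 1" if "a \<in> ?C" "b \<in> ?C" "a \<noteq> b" for a b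
      using share that V by (auto simp: card_le_Suc0_iff_eq)
    have "?W - {w} \<subseteq> ?P (s x) (s y) \<union> ?P (s x) (s z) \<union> ?P (s y) (s z)"
    proof
      fix v assume v: "v \<in> ?W - {w}"
      have "R v (s x) \<or> R v (s y)" "R v (s x) \<or> R v (s z)" "R v (s y) \<or> R v (s z)"
        using most[OF v, of "s x" "s y" "s z"] most[OF v, of "s x" "s z" "s y"]
          most[OF v, of "s y" "s z" "s x"] sne by (auto simp: insert_commute)
      then show "v \<in> ?P (s x) (s y) \<union> ?P (s x) (s z) \<union> ?P (s y) (s z)" using v by blast
    qed
    then have "card (?W - {w}) \<le> card (?P (s x) (s y) \<union> ?P (s x) (s z) \<union> ?P (s y) (s z))"
      using V by (intro card_mono) auto
    also have "\<dots> \<le> card (?P (s x) (s y)) + card (?P (s x) (s z)) + card (?P (s y) (s z))"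
      using card_Un_le[of "?P (s x) (s y) \<union> ?P (s x) (s z)" "?P (s y) (s z)"]
        card_Un_le[of "?P (s x) (s y)" "?P (s x) (s z)"] by linarith
    also have "\<dots> \<le> 3"
      using le1[OF sin(1,2) sne(1)] le1[OF sin(1,3) sne(2)] le1[OF sin(2,3) sne(3)] by linarith
    \<comment> \<open>\<open>?W - {w}\<close> has at least four elements, more than the three pairs
      can account for.\<close>
    finally show False using W h(1) V by simp
  qed
  let ?N = "\<lambda>w. {x \<in> ?C. R w x}"
  have N2: "card (?N w) \<le> 2" if w: "w \<in> ?W" for w
  proof (rule ccontr)
    assume "\<not> ?thesis"
    then obtain T where "T \<subseteq> ?N w" "card T = 3"
      using obtain_subset_with_card_n[of 3 "?N w"] by auto
    then show False using three[OF w] by (auto simp: card_3_iff)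
  qed
  have N1: "card (?N v \<inter> ?N w) \<le> 1" if "v \<in> ?W" "w \<in> ?W" "v \<noteq> w" for v w
    using share that by (auto simp: card_le_Suc0_iff_eq)
  show ?thesis unfolding clique_in_def
  proof (intro ballI impI, rule ccontr)
    fix v w assume vw: "v \<in> ?W" "w \<in> ?W" "v \<noteq> w" "\<not> R v w"
    have "card (?W - {v, w}) \<ge> 3" using W vw V by (simp add: card_Diff_subset)
    then obtain u where u: "u \<in> ?W" "u \<noteq> v" "u \<noteq> w" by (cases "?W - {v, w} = {}") auto
    have meet: "?C - ?N a - ?N b \<noteq> {}" if "a \<in> ?W" "b \<in> ?W" for a b
    proof
      assume "?C - ?N a - ?N b = {}"
      then have "card ?C \<le> card (?N a \<union> ?N b)" by (intro card_mono) auto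
      then show False using N2[OF that(1)] N2[OF that(2)] card_Un_le[of "?N a" "?N b"] cardC m
        by linarith
    qed
    \<comment> \<open>If no distinct pair existed, both sets would be \<open>{c}\<close>, so every
      cycle vertex other than \<open>c\<close> would lie in \<open>?N u\<close> or in both
      \<open>?N v\<close> and \<open>?N w\<close>: at most 1 + 2 + 1 vertices, fewer than
      \<open>m\<close>.\<close>
    have "\<exists>c d. c \<in> ?C - ?N v - ?N u \<and> d \<in> ?C - ?N u - ?N w \<and> c \<noteq> d"
    proof (rule ccontr)
      assume n: "\<not> ?thesis"
      obtain c where c: "c \<in> ?C - ?N v - ?N u" using meet vw(1) u(1) by blast
      then have D2: "?C - ?N u - ?N w \<subseteq> {c}" using n by blast
      obtain d where "d \<in> ?C - ?N u - ?N w" using meet vw(2) u(1) by blast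
      then have D1: "?C - ?N v - ?N u \<subseteq> {c}" using n D2 by blast
      have "?C \<subseteq> insert c (?N u) \<union> (?N v \<inter> ?N w)" using D1 D2 by blast
      then have "card ?C \<le> card (insert c (?N u) \<union> (?N v \<inter> ?N w))" by (intro card_mono) auto
      also have "\<dots> \<le> card (insert c (?N u)) + card (?N v \<inter> ?N w)" by (rule card_Un_le)
      also have "\<dots> \<le> 3 + 1"
        using N1[OF vw(1,2,3)] N2[OF u(1)] card_insert_le_m1[of 3 "?N u" c] by linarith
      finally show False using cardC m by simp
    qed
    then obtain c d where "c \<in> ?C - ?N v - ?N u" "d \<in> ?C - ?N u - ?N w" "c \<noteq> d" by blast
    then show False
      by (intro no5[of v c u d w]) (use vw u cyc(3) comm in auto)
  qed
qed

lemma obtain_two: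
  assumes "2 \<le> card S" obtains x y where "x \<in> S" "y \<in> S" "x \<noteq> y"
proof -
  obtain T where "T \<subseteq> S" "card T = 2" using obtain_subset_with_card_n[OF assms] by auto
  then show ?thesis using that by (auto simp: card_2_iff)
qed

lemma obtain_three:
  assumes "3 \<le> card S" obtains x y z where "x \<in> S" "y \<in> S" "z \<in> S" "x \<noteq> y" "x \<noteq> z" "y \<noteq> z"
proof -
  obtain T where "T \<subseteq> S" "card T = 3" using obtain_subset_with_card_n[OF assms] by auto
  then show ?thesis using that by (auto simp: card_3_iff)
qed

section \<open>Monochromatic short cycles\<close>

lemma monochromatic_C3_of_degree_3:
  assumes "symp R" "finite V" "v \<in> V" "3 \<le> card {u \<in> V - {v}. R v u}"
  shows "has_cycle R V 3 \<or> has_cycle (\<lambda>x y. \<not> R x y) V 3"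
proof -
  have comm: "R a b \<longleftrightarrow> R b a" for a b using assms(1) by (auto dest: sympD)
  obtain x y z where h: "x \<in> V - {v}" "y \<in> V - {v}" "z \<in> V - {v}" "R v x" "R v y" "R v z"
    "x \<noteq> y" "x \<noteq> z" "y \<noteq> z"
    by (rule obtain_three[OF assms(4)]) blast
  show ?thesis
  proof (cases "R x y \<or> R x z \<or> R y z")
    case True
    then show ?thesis
      using has_cycle_3[of R v x y V] has_cycle_3[of R v x z V] has_cycle_3[of R v y z V]
        h comm assms(3) by auto
  next
    case False
    then show ?thesis
      using has_cycle_3[of "\<lambda>x y. \<not> R x y" x y z V] h comm[of x z] by auto
  qed
qed

lemma monochromatic_C3:
  assumes sym: "symp R" and V: "finite V" "6 \<le> card V"
  shows "has_cycle R V 3 \<or> has_cycle (\<lambda>x y. \<not> R x y) V 3"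
proof -
  have sym': "symp (\<lambda>x y. \<not> R x y)" using sym by (auto simp: symp_def)
  obtain v where v: "v \<in> V" using V by (cases "V = {}") auto
  have "V - {v} = {u \<in> V - {v}. R v u} \<union> {u \<in> V - {v}. \<not> R v u}" by blast
  then have "card (V - {v}) \<le> card {u \<in> V - {v}. R v u} + card {u \<in> V - {v}. \<not> R v u}"
    by (metis card_Un_le)
  then consider "3 \<le> card {u \<in> V - {v}. R v u}" | "3 \<le> card {u \<in> V - {v}. \<not> R v u}"
    using V v by fastforce
  then show ?thesis
  proof cases
    case 1
    then show ?thesis using monochromatic_C3_of_degree_3[OF sym V(1) v] by blast
  next
    case 2
    then show ?thesis
      using monochromatic_C3_of_degree_3[where R = "\<lambda>x y. \<not> R x y", OF sym' V(1) v 2] by auto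
  qed
qed

text \<open>Let \<open>S\<close> consist of five red neighbours of \<open>v\<close>. Two red edges
  from a vertex \<open>t\<close> into \<open>S\<close> close a red \<open>C\<^sub>4\<close> through
  \<open>v\<close>. Otherwise two vertices outside have at most one red neighbour each in
  \<open>S\<close>, and their common blue neighbours there give a blue
  \<open>C\<^sub>4\<close>.\<close>

lemma monochromatic_C4_of_degree_5:
  assumes "symp R" "finite V" "v \<in> V" "5 \<le> card {u \<in> V - {v}. R v u}" "10 \<le> card V"
  shows "has_cycle R V 4 \<or> has_cycle (\<lambda>x y. \<not> R x y) V 4"
proof -
  have comm: "R a b \<longleftrightarrow> R b a" for a b using assms(1) by (auto dest: sympD)
  obtain S where S: "S \<subseteq> {u \<in> V - {v}. R v u}" "card S = 5" "finite S"
    using obtain_subset_with_card_n[OF assms(4)] by auto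
  have "v \<notin> S" "insert v S \<subseteq> V" using S(1) assms(3) by auto
  then have "card (V - insert v S) = card V - 6"
    using S(2,3) by (simp add: card_Diff_subset)
  then have "2 \<le> card (V - insert v S)" using assms(5) by simp
  then obtain u w where uw: "u \<in> V - insert v S" "w \<in> V - insert v S" "u \<noteq> w"
    by (rule obtain_two)
  show ?thesis
  proof (cases "\<exists>t\<in>V - insert v S. \<exists>x\<in>S. \<exists>y\<in>S. x \<noteq> y \<and> R t x \<and> R t y")
    case True
    then obtain t x y where h: "t \<in> V - insert v S" "x \<in> S" "y \<in> S" "x \<noteq> y" "R t x" "R t y" by blast
    then have "R v x" "R y v" "x \<in> V - {v}" "y \<in> V - {v}" using S comm by auto
    then have "has_cycle R V 4" using h comm assms(3) by (intro has_cycle_4[of R v x t y]) auto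
    then show ?thesis by blast
  next
    case False
    then have "card {x \<in> S. R u x} \<le> 1" "card {x \<in> S. R w x} \<le> 1"
      using uw S(3) by (fastforce simp: card_le_Suc0_iff_eq)+
    moreover have "S \<subseteq> (S - {x \<in> S. R u x} - {x \<in> S. R w x}) \<union> {x \<in> S. R u x} \<union> {x \<in> S. R w x}"
      (is "_ \<subseteq> ?D \<union> ?X \<union> ?Y") by blast
    then have "card S \<le> card (?D \<union> ?X \<union> ?Y)" using S(3) by (intro card_mono) auto
    then have "card S \<le> card ?D + card ?X + card ?Y"
      using card_Un_le[of ?D ?X] card_Un_le[of "?D \<union> ?X" ?Y] by linarith
    ultimately have "2 \<le> card ?D" using S(2) by linarith
    then obtain x y where "x \<in> ?D" "y \<in> ?D" "x \<noteq> y" using obtain_two by blast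
    then have "has_cycle (\<lambda>x y. \<not> R x y) V 4"
      using uw comm S(1) by (intro has_cycle_4[of _ u x w y]) auto
    then show ?thesis by blast
  qed
qed

lemma monochromatic_C4:
  assumes sym: "symp R" and V: "finite V" "10 \<le> card V"
  shows "has_cycle R V 4 \<or> has_cycle (\<lambda>x y. \<not> R x y) V 4"
proof -
  have sym': "symp (\<lambda>x y. \<not> R x y)" using sym by (auto simp: symp_def)
  obtain v where v: "v \<in> V" using V by (cases "V = {}") auto
  have "V - {v} = {u \<in> V - {v}. R v u} \<union> {u \<in> V - {v}. \<not> R v u}" by blast
  then have "card (V - {v}) \<le> card {u \<in> V - {v}. R v u} + card {u \<in> V - {v}. \<not> R v u}"
    by (metis card_Un_le)
  then consider "5 \<le> card {u \<in> V - {v}. R v u}" | "5 \<le> card {u \<in> V - {v}. \<not> R v u}"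
    using V v by fastforce
  then show ?thesis
  proof cases
    case 1
    then show ?thesis using monochromatic_C4_of_degree_5[OF sym V(1) v] V by blast
  next
    case 2
    then show ?thesis
      using monochromatic_C4_of_degree_5[where R = "\<lambda>x y. \<not> R x y", OF sym' V(1) v 2 V(2)] by auto
  qed
qed

text \<open>A hypothetical counterexample. The assumptions are invariant under exchanging the
  colours, so whatever is shown for red cycles also holds for blue ones by a second
  interpretation.\<close>

locale no_monochromatic_C5 =
  fixes R :: "'a \<Rightarrow> 'a \<Rightarrow> bool" and V :: "'a set"
  assumes sym: "symp R" and fin: "finite V" and card_V: "10 \<le> card V"
    and no_red: "\<not> has_cycle R V 5" and no_blue: "\<not> has_cycle (\<lambda>x y. \<not> R x y) V 5"
begin

lemma comm: "R x y \<longleftrightarrow> R y x"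
  using sym by (auto dest: sympD)

lemma red5: "R a b \<Longrightarrow> R b c \<Longrightarrow> R c d \<Longrightarrow> R d e \<Longrightarrow> R e a \<Longrightarrow> distinct [a, b, c, d, e] \<Longrightarrow>
    {a, b, c, d, e} \<subseteq> V \<Longrightarrow> False"
  using has_cycle_5[of R a b c d e V] no_red by blast

lemma blue5: "\<not> R a b \<Longrightarrow> \<not> R b c \<Longrightarrow> \<not> R c d \<Longrightarrow> \<not> R d e \<Longrightarrow> \<not> R e a \<Longrightarrow>
    distinct [a, b, c, d, e] \<Longrightarrow> {a, b, c, d, e} \<subseteq> V \<Longrightarrow> False"
  using has_cycle_5[of "\<lambda>x y. \<not> R x y" a b c d e V] no_blue by blast

definition red_C4 :: "'a \<Rightarrow> 'a \<Rightarrow> 'a \<Rightarrow> 'a \<Rightarrow> bool" where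
  "red_C4 a b c d \<longleftrightarrow> R a b \<and> R b c \<and> R c d \<and> R d a \<and> distinct [a, b, c, d] \<and> {a, b, c, d} \<subseteq> V"

lemma red_C4_rotate: "red_C4 a b c d \<Longrightarrow> red_C4 b c d a"
  by (auto simp: red_C4_def)

text \<open>Otherwise \<open>w\<close> could be inserted between two consecutive vertices, giving a
  red \<open>C\<^sub>5\<close>.\<close>

lemma red_C4_nonadjacent:
  assumes "red_C4 a b c d" "w \<in> V - {a, b, c, d}" "R w a"
  shows "\<not> R w b" "\<not> R w d"
  using red5[of w a d c b] red5[of w a b c d] assms comm by (auto simp: red_C4_def)

text \<open>A red edge \<open>u v\<close> would close the red cycle
  \<open>a, u, v, c, b\<close>.\<close>

lemma red_C4_opposite_pair:
  assumes "red_C4 a b c d" "u \<in> V - {a, b, c, d}" "v \<in> V - {a, b, c, d}" "u \<noteq> v"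
    "R u a" "R u c" "R v a" "R v c"
  shows "\<not> R u v"
  using red5[of a u v c b] assms comm by (auto simp: red_C4_def)

text \<open>All three are blue to \<open>b\<close> and \<open>d\<close>, and they are pairwise blue
  by \<open>red_C4_opposite_pair\<close>.\<close>

lemma red_C4_opposite_three:
  assumes "red_C4 a b c d" "u \<in> V - {a, b, c, d}" "v \<in> V - {a, b, c, d}" "w \<in> V - {a, b, c, d}"
    "u \<noteq> v" "u \<noteq> w" "v \<noteq> w" "R u a" "R u c" "R v a" "R v c" "R w a" "R w c"
  shows False
proof (rule blue5[of u b v d w])
  show "\<not> R w u" using red_C4_opposite_pair assms by blast
qed (use red_C4_nonadjacent[OF assms(1,2)] red_C4_nonadjacent[OF assms(1,3)]
    red_C4_nonadjacent[OF assms(1,4)] assms comm in \<open>auto simp: red_C4_def\<close>)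

text \<open>\<open>u\<close> and \<open>v\<close> are blue to each other and to \<open>b\<close>,
  \<open>d\<close>, which forces every other outside vertex to be red to \<open>b\<close> or
  \<open>d\<close>, hence blue to \<open>a\<close> and \<open>c\<close>. Those red to both
  (\<open>?B\<close>) and those red to exactly one (\<open>?O\<close>) number at most two each,
  while at least four vertices remain; so both classes are inhabited enough to yield a blue
  \<open>C\<^sub>5\<close>.\<close>

lemma red_C4_opposite_two:
  assumes C: "red_C4 a b c d" and u: "u \<in> V - {a, b, c, d}" and v: "v \<in> V - {a, b, c, d}"
    and "u \<noteq> v" and R: "R u a" "R u c" "R v a" "R v c"
  shows False
proof -
  let ?W = "V - {a, b, c, d}" and ?X = "V - {a, b, c, d} - {u, v}"
  note C' = red_C4_rotate[OF C] and CV = C[unfolded red_C4_def]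
  have C3: "red_C4 d a b c" using C' red_C4_rotate by blast
  have nonadj: "\<not> R w a \<and> \<not> R w c" if "w \<in> ?W" "R w b \<or> R w d" for w
    using red_C4_nonadjacent[OF C'] red_C4_nonadjacent[OF C3] that by (auto simp: insert_commute)
  have uv: "\<not> R u v" using red_C4_opposite_pair[OF C u v \<open>u \<noteq> v\<close>] R by blast
  have K4: "\<not> R u b" "\<not> R u d" "\<not> R v b" "\<not> R v d"
    using red_C4_nonadjacent[OF C u] red_C4_nonadjacent[OF C v] R by auto
  have bd: "R w b \<or> R w d" if "w \<in> ?X" for w
    using blue5[of w b u v d] that u v \<open>u \<noteq> v\<close> K4 uv CV comm by auto
  then have ac: "\<not> R w a" "\<not> R w c" if "w \<in> ?X" for w using nonadj that by auto
  let ?B = "{w \<in> ?X. R w b \<and> R w d}" and ?O = "{w \<in> ?X. \<not> (R w b \<and> R w d)}"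
  \<comment> \<open>\<open>u, b, v, d\<close> is a blue 4-cycle. As \<open>w\<close> is blue to
    \<open>b\<close> or \<open>d\<close>, it could be inserted there if it were also blue to
    \<open>u\<close> or \<open>v\<close>.\<close>
  have Ouv: "R w u \<and> R w v" if "w \<in> ?O" for w
    using blue5[of w b u d v] blue5[of w b v d u] blue5[of w d u b v] blue5[of w d v b u]
      that u v \<open>u \<noteq> v\<close> K4 CV comm by auto
  have OO: "\<not> R x y" if "x \<in> ?O" "y \<in> ?O" "x \<noteq> y" for x y
    using red5[of x y u a v] that Ouv[OF that(1)] Ouv[OF that(2)] u v \<open>u \<noteq> v\<close> R CV comm by auto
  \<comment> \<open>\<open>?O\<close> is blue inside and blue to \<open>a\<close> and
    \<open>c\<close>; three of its vertices would give the blue cycle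
    \<open>a, x, c, y, z\<close>.\<close>
  have O3: "card ?O < 3"
  proof (rule ccontr)
    assume "\<not> ?thesis"
    then have "3 \<le> card ?O" by linarith
    then obtain x y z where h: "x \<in> ?O" "y \<in> ?O" "z \<in> ?O" "x \<noteq> y" "x \<noteq> z" "y \<noteq> z"
      by (rule obtain_three)
    then show False
      using blue5[of a x c y z] ac[of x] ac[of y] ac[of z] OO[OF h(2,3,6)] CV comm by auto
  qed
  have B3: "card ?B < 3"
  proof (rule ccontr)
    assume "\<not> ?thesis"
    then have "3 \<le> card ?B" by linarith
    then obtain x y z where h: "x \<in> ?B" "y \<in> ?B" "z \<in> ?B" "x \<noteq> y" "x \<noteq> z" "y \<noteq> z"
      by (rule obtain_three)
    then show False using red_C4_opposite_three[OF C', of x y z] by auto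
  qed
  have "card {a, b, c, d} = 4" using CV by auto
  then have "6 \<le> card ?W" using card_V CV fin by (subst card_Diff_subset) auto
  then have "4 \<le> card ?X" using u v \<open>u \<noteq> v\<close> by (subst card_Diff_subset) auto
  moreover have "card ?X = card ?B + card ?O"
    using fin by (subst card_Un_disjoint[symmetric]) (auto intro!: arg_cong[where f = card])
  ultimately have "2 \<le> card ?B" "2 \<le> card ?O" using O3 B3 by auto
  obtain x y where xy: "x \<in> ?B" "y \<in> ?B" "x \<noteq> y" by (rule obtain_two[OF \<open>2 \<le> card ?B\<close>])
  obtain z where z: "z \<in> ?O" by (rule obtain_two[OF \<open>2 \<le> card ?O\<close>])
  note h = xy z
  \<comment> \<open>\<open>x\<close> and \<open>y\<close> are both red to the opposite vertices
    \<open>b\<close> and \<open>d\<close>, so the pair lemma applies to the rotated cycle.\<close>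
  have "\<not> R x y" using red_C4_opposite_pair[OF C', of x y] xy by (auto simp: insert_commute)
  then show False
    using blue5[of x y a z c] h ac[of x] ac[of y] ac[of z] CV comm by auto
qed

text \<open>Outside a red \<open>C\<^sub>4\<close> on \<open>Q\<close>, the classes \<open>A\<close>
  and \<open>B\<close> have at most one vertex each. The others (\<open>U\<close>) have at most one
  red neighbour in \<open>Q\<close> and form a red clique, which has at most four vertices as there
  is no red \<open>C\<^sub>5\<close>. Counting then makes \<open>A\<close> nonempty, and its vertex
  completes a monochromatic \<open>C\<^sub>5\<close>.\<close>

lemma no_red_C4: "\<not> has_cycle R V 4"
proof
  assume "has_cycle R V 4"
  then obtain a b c d where C: "red_C4 a b c d"
    by (rule has_cycle_4E) (auto simp: red_C4_def)
  define Q where "Q = {a, b, c, d}"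
  note C' = red_C4_rotate[OF C] and CV = C[unfolded red_C4_def]
  have C2: "red_C4 c d a b" using C C' red_C4_rotate by blast
  define A where "A = {w \<in> V - Q. R w a \<and> R w c}"
  define B where "B = {w \<in> V - Q. R w b \<and> R w d}"
  define U where "U = V - Q - A - B"
  have fins: "finite A" "finite B" "finite U" "finite Q" using fin by (auto simp: A_def B_def U_def Q_def)
  have A1: "card A \<le> 1"
    using red_C4_opposite_two[OF C] fins by (auto simp: card_le_Suc0_iff_eq A_def Q_def)
  have B1: "card B \<le> 1"
    using red_C4_opposite_two[OF C'] fins
    by (auto simp: card_le_Suc0_iff_eq B_def Q_def insert_commute)
  have card_Q: "card Q = 4" using CV by (auto simp: Q_def)
  moreover have "Q \<subseteq> V" using CV by (simp add: Q_def)
  ultimately have W6: "6 \<le> card (V - Q)" using card_V fins by (simp add: card_Diff_subset)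
  have "V - Q \<subseteq> U \<union> A \<union> B" by (auto simp: U_def)
  then have "card (V - Q) \<le> card (U \<union> A \<union> B)" using fins by (intro card_mono) auto
  then have W_le: "card (V - Q) \<le> card U + card A + card B"
    using card_Un_le[of U A] card_Un_le[of "U \<union> A" B] by linarith
  have U: "w \<in> V" "w \<notin> Q" "\<not> (R w a \<and> R w c)" "\<not> (R w b \<and> R w d)" if "w \<in> U" for w
    using that by (auto simp: U_def A_def B_def)
  define N where "N w = {x \<in> Q. R w x}" for w
  have N1: "card (N w) \<le> 1" if w: "w \<in> U" for w
  proof -
    have wW: "w \<in> V - {a, b, c, d}" "w \<in> V - {c, d, a, b}" using U(1,2)[OF w] by (auto simp: Q_def)
    have "R w a \<Longrightarrow> \<not> R w b \<and> \<not> R w d" "R w c \<Longrightarrow> \<not> R w b \<and> \<not> R w d"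
      using red_C4_nonadjacent[OF C wW(1)] red_C4_nonadjacent[OF C2 wW(2)] by auto
    then have "\<forall>x\<in>N w. \<forall>y\<in>N w. x = y" using U(3,4)[OF w] unfolding N_def Q_def by blast
    moreover have "finite (N w)" using fins by (simp add: N_def)
    ultimately show ?thesis by (simp add: card_le_Suc0_iff_eq)
  qed
  have free: "2 \<le> card (Q - N x - N y)" if "x \<in> U" "y \<in> U" for x y
  proof -
    have "card Q \<le> card ((Q - N x - N y) \<union> N x \<union> N y)"
      using fins by (intro card_mono) (auto simp: N_def)
    then show ?thesis
      using card_Un_le[of "Q - N x - N y" "N x"] N1[OF that(1)] N1[OF that(2)] card_Q
        card_Un_le[of "(Q - N x - N y) \<union> N x" "N y"] by linarith
  qed
  \<comment> \<open>\<open>q\<close> is a vertex to be avoided; of two candidates at least one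
    differs from it.\<close>
  have pick: "\<exists>p\<in>Q. p \<noteq> q \<and> \<not> R x p \<and> \<not> R y p" if xy: "x \<in> U" "y \<in> U" for x y q
  proof -
    obtain p p' where "p \<in> Q - N x - N y" "p' \<in> Q - N x - N y" "p \<noteq> p'"
      by (rule obtain_two[OF free[OF xy]])
    then have "p \<in> Q \<and> \<not> R x p \<and> \<not> R y p" "p' \<in> Q \<and> \<not> R x p' \<and> \<not> R y p'" "p \<noteq> p'"
      by (auto simp: N_def)
    then show ?thesis by metis
  qed
  have inV: "x \<in> V" if "x \<in> Q" for x using that CV by (auto simp: Q_def)
  have UQ: "x \<noteq> y" if "x \<in> U" "y \<in> Q" for x y using U(2)[OF that(1)] that(2) by blast
  have U4: "4 \<le> card U" using W6 W_le A1 B1 by linarith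
  have UV: "U \<subseteq> V" using U(1) by blast
  have diff: "2 \<le> card (U - {x, y})" if "x \<in> U" "y \<in> U" "x \<noteq> y" for x y
    using that U4 fins by (simp add: card_Diff_subset)
  have clique: "clique_in R U" unfolding clique_in_def
  proof (intro ballI impI, rule ccontr)
    fix x y assume h: "x \<in> U" "y \<in> U" "x \<noteq> y" "\<not> R x y"
    \<comment> \<open>A third vertex \<open>z\<close> of \<open>U\<close> turns the blue edge
      \<open>x y\<close> into a blue 5-cycle, using a common blue neighbour in \<open>Q\<close> for
      each of the pairs \<open>x\<close>, \<open>z\<close> and \<open>z\<close>,
      \<open>y\<close>.\<close>
    obtain z where z: "z \<in> U - {x, y}" by (rule obtain_two[OF diff[OF h(1-3)]])
    then have zU: "z \<in> U" "z \<noteq> x" "z \<noteq> y" by auto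
    obtain p where p: "p \<in> Q" "\<not> R x p" "\<not> R z p" using pick[OF h(1) zU(1)] by blast
    obtain q where q: "q \<in> Q" "q \<noteq> p" "\<not> R z q" "\<not> R y q" using pick[OF zU(1) h(2)] by blast
    show False
    proof (rule blue5[of x p z q y])
      show "distinct [x, p, z, q, y]"
        using h(3) zU(2,3) q(2) UQ[OF h(1) p(1)] UQ[OF h(1) q(1)] UQ[OF h(2) p(1)] UQ[OF h(2) q(1)]
          UQ[OF zU(1) p(1)] UQ[OF zU(1) q(1)] by auto
      show "{x, p, z, q, y} \<subseteq> V" using inV p(1) q(1) U(1) h(1,2) zU(1) by blast
    qed (use h(4) p(2,3) q(3,4) comm in blast)+
  qed
  have "card U \<le> 4"
  proof (rule ccontr)
    assume "\<not> ?thesis"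
    then have "has_cycle R U 5" using clique fins by (intro clique_in_cycle) auto
    then show False using no_red has_cycle_mono[OF _ UV] by blast
  qed
  \<comment> \<open>At least six vertices lie outside \<open>Q\<close>, and \<open>U\<close> and
    \<open>B\<close> account for at most 4 + 1 of them.\<close>
  then have "card A \<noteq> 0" using W6 W_le B1 by linarith
  then have "A \<noteq> {}" by (metis card.empty)
  then obtain w where w: "w \<in> V - Q" "R w a" "R w c" unfolding A_def by blast
  have wU: "w \<notin> U" using U(3) w by blast
  \<comment> \<open>Two red neighbours of \<open>w\<close> in the red clique \<open>U\<close>,
    joined through two further vertices of \<open>U\<close>, would give a red 5-cycle.\<close>
  have w1: "card {x \<in> U. R w x} \<le> 1"
  proof (rule ccontr)
    assume "\<not> ?thesis"
    then have "2 \<le> card {x \<in> U. R w x}" by linarith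
    then obtain x y where "x \<in> {x \<in> U. R w x}" "y \<in> {x \<in> U. R w x}" "x \<noteq> y" by (rule obtain_two)
    then have xy: "x \<in> U" "y \<in> U" "R w x" "R w y" "x \<noteq> y" by auto
    obtain z t where zt: "z \<in> U - {x, y}" "t \<in> U - {x, y}" "z \<noteq> t"
      by (rule obtain_two[OF diff[OF xy(1,2,5)]])
    show False
    proof (rule red5[of w x z t y])
      show "R x z" "R z t" "R t y" using clique xy(1,2) zt by (auto simp: clique_in_def)
      show "distinct [w, x, z, t, y]" using xy zt wU by auto
      show "{w, x, z, t, y} \<subseteq> V" using xy(1,2) zt w(1) U(1) by auto
      show "R w x" "R y w" using xy(3,4) comm by blast+
    qed
  qed
  have "card U \<le> card ((U - {x \<in> U. R w x}) \<union> {x \<in> U. R w x})" using fins by (intro card_mono) auto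
  then have "2 \<le> card (U - {x \<in> U. R w x})"
    using card_Un_le[of "U - {x \<in> U. R w x}" "{x \<in> U. R w x}"] w1 U4 by linarith
  then obtain x y where "x \<in> U - {x \<in> U. R w x}" "y \<in> U - {x \<in> U. R w x}" "x \<noteq> y"
    by (rule obtain_two)
  then have xy: "x \<in> U" "y \<in> U" "\<not> R w x" "\<not> R w y" "x \<noteq> y" by auto
  \<comment> \<open>As a member of \<open>A\<close>, \<open>w\<close> is blue to both
    \<open>b\<close> and \<open>d\<close>, while \<open>y\<close> is red to at most one of
    them.\<close>
  obtain p where p: "p \<in> {b, d}" "\<not> R y p" using U(4)[OF xy(2)] by blast
  have pQ: "p \<in> Q" using p by (auto simp: Q_def)
  obtain q where q: "q \<in> Q" "q \<noteq> p" "\<not> R x q" "\<not> R y q" using pick[OF xy(1,2)] by blast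
  show False
  proof (rule blue5[of w x q y p])
    show "\<not> R w x" "\<not> R x q" "\<not> R y p" by fact+
    have "\<not> R w p" using red_C4_nonadjacent[OF C, of w] w p by (auto simp: Q_def)
    then show "\<not> R p w" using comm by blast
    show "\<not> R q y" using q(4) comm by blast
    show "distinct [w, x, q, y, p]"
      using w wU xy q pQ UQ by auto
    show "{w, x, q, y, p} \<subseteq> V" using w(1) xy(1,2) U(1) inV[OF pQ] inV[OF q(1)] by auto
  qed
qed

end

text \<open>Applied to both colours, \<open>no_red_C4\<close> excludes every monochromatic
  \<open>C\<^sub>4\<close>, against \<open>monochromatic_C4\<close>.\<close>

lemma monochromatic_C5:
  assumes sym: "symp R" and V: "finite V" "10 \<le> card V"
  shows "has_cycle R V 5 \<or> has_cycle (\<lambda>x y. \<not> R x y) V 5"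
proof (rule ccontr)
  assume n: "\<not> ?thesis"
  have sym': "symp (\<lambda>x y. \<not> R x y)" using sym by (auto simp: symp_def)
  interpret red: no_monochromatic_C5 R V using n sym V by unfold_locales auto
  interpret blue: no_monochromatic_C5 "\<lambda>x y. \<not> R x y" V
    using n sym' V by unfold_locales auto
  show False using monochromatic_C4[OF sym V] red.no_red_C4 blue.no_red_C4 by blast
qed

section \<open>Forcing long red cycles\<close>

lemma clique_outside_cycle:
  assumes "k \<in> {3, 5}" "k \<le> m" "symp R" "finite V" "cycle_list R xs" "length xs = m" "set xs \<subseteq> V"
    and "2 * m \<le> card V" "\<not> has_cycle R V (Suc m)" "\<not> has_cycle (\<lambda>x y. \<not> R x y) V k"
  shows "clique_in R (V - set xs)"
proof -
  have "card (set xs) = m" using assms by (simp add: cycle_list_def distinct_card)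
  then have "m \<le> card (V - set xs)" using assms by (simp add: card_Diff_subset)
  then show ?thesis
    using assms clique_outside_cycle_3[of R V xs m] clique_outside_cycle_5[of R V xs m] by auto
qed

text \<open>The induction starts at \<open>m = k\<close>, with 6 vertices for
  \<open>C\<^sub>3\<close> and 10 for \<open>C\<^sub>5\<close>. In the step, at least
  \<open>m + 2\<close> vertices lie outside a red cycle of length \<open>m\<close>; were there no
  longer cycle, they would form a red clique, which contains one.\<close>

lemma has_cycle_of_double:
  assumes k: "k \<in> {3, 5}" "k \<le> m" and sym: "symp R" and fin: "finite V"
    and V: "2 * m \<le> card V" and noB: "\<not> has_cycle (\<lambda>x y. \<not> R x y) V k"
  shows "has_cycle R V m"
  using k(2) V
proof (induction m rule: dec_induct)
  case base
  then show ?case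
    using k(1) monochromatic_C3[OF sym fin] monochromatic_C5[OF sym fin] noB by auto
next
  case (step m)
  then obtain xs where xs: "cycle_list R xs" "length xs = m" "set xs \<subseteq> V"
    by (auto simp: has_cycle_def)
  show ?case
  proof (rule ccontr)
    assume n: "\<not> has_cycle R V (Suc m)"
    have clq: "clique_in R (V - set xs)"
      by (rule clique_outside_cycle[OF k(1) step(1) sym fin xs _ n noB]) (use step in simp)
    have "card (set xs) = m" using xs by (simp add: cycle_list_def distinct_card)
    then have "Suc m \<le> card (V - set xs)" using xs step fin by (simp add: card_Diff_subset)
    then have "has_cycle R (V - set xs) (Suc m)"
      using clq fin k step by (intro clique_in_cycle) auto
    then show False using n has_cycle_mono by blast
  qed
qed

text \<open>A red cycle of length \<open>n - 1\<close> leaves at least \<open>n\<close> vertices,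
  just enough for the red clique outside it to contain a cycle of length \<open>n\<close>. This is
  the upper bound for the Ramsey number.\<close>

lemma has_cycle_of_order:
  assumes k: "k \<in> {3, 5}" "k < n" and sym: "symp R" and fin: "finite V"
    and V: "2 * n - 1 \<le> card V" and noB: "\<not> has_cycle (\<lambda>x y. \<not> R x y) V k"
  shows "has_cycle R V n"
proof (rule ccontr)
  assume n: "\<not> has_cycle R V n"
  have "has_cycle R V (n - 1)"
    by (rule has_cycle_of_double[OF k(1) _ sym fin _ noB]) (use k V in auto)
  then obtain xs where xs: "cycle_list R xs" "length xs = n - 1" "set xs \<subseteq> V"
    by (auto simp: has_cycle_def)
  have clq: "clique_in R (V - set xs)"
    by (rule clique_outside_cycle[OF k(1) _ sym fin xs _ _ noB]) (use k n V in auto)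
  have "card (set xs) = n - 1" using xs by (simp add: cycle_list_def distinct_card)
  then have "n \<le> card (V - set xs)" using xs V fin by (simp add: card_Diff_subset)
  then have "has_cycle R (V - set xs) n"
    using clq fin k by (intro clique_in_cycle) auto
  then show False using n has_cycle_mono by blast
qed

section \<open>Structure of critical colourings\<close>

text \<open>The last conjunct expresses that at most one red edge joins the parts. If they partition
  the vertices, the blue graph is complete bipartite up to one missing edge.\<close>

definition two_cliques :: "('a \<Rightarrow> 'a \<Rightarrow> bool) \<Rightarrow> 'a set \<Rightarrow> 'a set \<Rightarrow> bool" where
  "two_cliques R A B \<longleftrightarrow> clique_in R A \<and> clique_in R B \<and>
     (\<forall>a\<in>A. \<forall>b\<in>B. \<forall>a'\<in>A. \<forall>b'\<in>B. R a b \<longrightarrow> R a' b' \<longrightarrow> a = a' \<and> b = b')"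

text \<open>A path through \<open>n - 1\<close> vertices of the clique from \<open>b\<close> to
  \<open>b'\<close> is closed by \<open>a\<close>.\<close>

lemma cycle_of_common_neighbour:
  assumes clq: "clique_in R B" "finite B" and n: "2 \<le> n - 1" "n - 1 \<le> card B"
    and a: "a \<notin> B" and b: "b \<in> B" "b' \<in> B" "b \<noteq> b'" and R: "R a b" "R b' a"
  shows "has_cycle R (insert a B) n"
proof -
  obtain ys where ys: "distinct ys" "length ys = n - 1" "set ys \<subseteq> B" "hd ys = b" "last ys = b'"
    "successively R ys"
    by (rule clique_in_path[OF clq b n])
  have "ys \<noteq> []" using ys n by auto
  then have "cycle_list R (a # ys)" using ys a R by (auto simp: cycle_list_def successively_Cons)
  then show ?thesis using ys n by (intro has_cycleI[of _ "a # ys"]) auto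
qed

text \<open>The cycle runs through \<open>a\<close>, \<open>a'\<close> and then along
  \<open>n - 2\<close> vertices of \<open>B\<close> from \<open>b'\<close> back to
  \<open>b\<close>.\<close>

lemma cycle_of_two_links:
  assumes sym: "symp R" and clq: "clique_in R A" "clique_in R B" "finite B" and AB: "A \<inter> B = {}"
    and n: "2 \<le> n - 2" "n - 2 \<le> card B"
    and ab: "a \<in> A" "a' \<in> A" "b \<in> B" "b' \<in> B" "a \<noteq> a'" "b \<noteq> b'" and R: "R a b" "R a' b'"
  shows "has_cycle R (A \<union> B) n"
proof -
  obtain ys where ys: "distinct ys" "length ys = n - 2" "set ys \<subseteq> B" "hd ys = b'" "last ys = b"
    "successively R ys"
    by (rule clique_in_path[OF clq(2,3) ab(4,3) ab(6)[symmetric] n])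
  have "ys \<noteq> []" using ys n by auto
  moreover have "R a a'" using clq ab by (simp add: clique_in_def)
  moreover have "R b a" using R sym by (auto dest: sympD)
  moreover have "a \<notin> set ys" "a' \<notin> set ys" using ab AB ys by auto
  ultimately have "cycle_list R (a # a' # ys)"
    using ys ab R by (auto simp: cycle_list_def successively_Cons)
  then show ?thesis using ys n ab by (intro has_cycleI[of _ "a # a' # ys"]) auto
qed

lemma two_cliques_of_critical:
  assumes k: "k \<in> {3, 5}" "k < n" and sym: "symp R" and fin: "finite V"
    and V: "card V = 2 * (n - 1)" and noR: "\<not> has_cycle R V n"
    and noB: "\<not> has_cycle (\<lambda>x y. \<not> R x y) V k"
  obtains A B where "V = A \<union> B" "A \<inter> B = {}" "card A = n - 1" "card B = n - 1" "two_cliques R A B"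
proof -
  have n4: "4 \<le> n" using k by auto
  have clq: "clique_in R (V - set xs) \<and> card (V - set xs) = n - 1"
    if xs: "cycle_list R xs" "length xs = n - 1" "set xs \<subseteq> V" for xs
  proof
    show "clique_in R (V - set xs)"
      by (rule clique_outside_cycle[OF k(1) _ sym fin xs _ _ noB]) (use k noR V in auto)
    have "card (set xs) = n - 1" using xs by (simp add: cycle_list_def distinct_card)
    then show "card (V - set xs) = n - 1" using xs V fin by (simp add: card_Diff_subset)
  qed
  have "has_cycle R V (n - 1)"
    by (rule has_cycle_of_double[OF k(1) _ sym fin _ noB]) (use k V in auto)
  then obtain xs where xs: "cycle_list R xs" "length xs = n - 1" "set xs \<subseteq> V"
    by (auto simp: has_cycle_def)
  define A where "A = V - set xs"
  have A: "clique_in R A" "card A = n - 1" "finite A" using clq[OF xs] fin by (auto simp: A_def)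
  \<comment> \<open>The argument is repeated with a cycle \<open>ys\<close> spanning
    \<open>A\<close>: the vertices outside it are those of \<open>xs\<close>, so they form a red
    clique as well.\<close>
  have "has_cycle R A (n - 1)" by (rule clique_in_cycle) (use A n4 in auto)
  then obtain ys where ys: "cycle_list R ys" "length ys = n - 1" "set ys \<subseteq> A"
    by (auto simp: has_cycle_def)
  have "card (set ys) = n - 1" using ys by (simp add: cycle_list_def distinct_card)
  then have "set ys = A" using ys A card_subset_eq by metis
  define B where "B = V - A"
  have "A \<subseteq> V" by (auto simp: A_def)
  then have B: "clique_in R B" "card B = n - 1" "finite B"
    using clq[OF ys(1,2)] fin \<open>set ys = A\<close> by (auto simp: B_def)
  have VAB: "V = A \<union> B" "A \<inter> B = {}" using \<open>A \<subseteq> V\<close> by (auto simp: B_def)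
  have "a = a' \<and> b = b'" if h: "a \<in> A" "b \<in> B" "a' \<in> A" "b' \<in> B" "R a b" "R a' b'" for a b a' b'
  proof (rule ccontr)
    assume ne: "\<not> ?thesis"
    have h': "R b a" "R b' a'" using h sym by (auto dest: sympD)
    have nin: "a \<notin> B" "b \<notin> A" using h VAB by auto
    have n': "2 \<le> n - 1" "2 \<le> n - 2" using n4 by auto
    \<comment> \<open>Two different cross edges meet in \<open>A\<close>, meet in \<open>B\<close>,
      or are disjoint.\<close>
    consider "a = a'" "b \<noteq> b'" | "a \<noteq> a'" "b = b'" | "a \<noteq> a'" "b \<noteq> b'" using ne by blast
    then have "has_cycle R V n"
    proof cases
      case 1
      then have "has_cycle R (insert a B) n"
        using cycle_of_common_neighbour[OF B(1,3) n'(1), of a b b'] h h' nin B(2) by auto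
      then show ?thesis using has_cycle_mono[of R "insert a B"] VAB h by blast
    next
      case 2
      then have "has_cycle R (insert b A) n"
        using cycle_of_common_neighbour[OF A(1,3) n'(1), of b a a'] h h' nin A(2) by auto
      then show ?thesis using has_cycle_mono[of R "insert b A"] VAB h by blast
    next
      case 3
      then show ?thesis
        using cycle_of_two_links[OF sym A(1) B(1,3) VAB(2) n'(2), of a a' b b'] h B(2) VAB by auto
    qed
    then show False using noR by blast
  qed
  then have "two_cliques R A B" using A B unfolding two_cliques_def by blast
  then show ?thesis using that VAB A B by blast
qed

section \<open>Colourings without the forbidden cycles\<close>

lemma cycle_list_crossing:
  assumes cyc: "cycle_list E xs" and x: "x \<in> set xs" "P x" and y: "y \<in> set xs" "\<not> P y"
  obtains i where "i < length xs" "P (xs ! i)" "\<not> P (xs ! (Suc i mod length xs))"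
proof (rule ccontr)
  let ?m = "length xs"
  note crossing = that
  assume no: "\<not> thesis"
  have step: "P (xs ! (Suc i mod ?m))" if "i < ?m" "P (xs ! i)" for i
    using crossing[OF that] no by blast
  obtain i j where i: "i < ?m" "xs ! i = x" and j: "j < ?m" "xs ! j = y"
    using x y by (auto simp: in_set_conv_nth)
  \<comment> \<open>If the cycle never left \<open>P\<close>, the property would spread from index
    \<open>i\<close> all the way round; \<open>l = j + ?m - i\<close> reaches index
    \<open>j\<close>.\<close>
  have "P (xs ! ((i + l) mod ?m))" for l
  proof (induction l)
    case 0
    then show ?case using i x by simp
  next
    case (Suc l)
    have "(i + l) mod ?m < ?m" using i by (intro mod_less_divisor) auto
    from step[OF this Suc] show ?case by (simp add: mod_Suc_eq)
  qed
  from this[of "j + ?m - i"] show False using i j y by simp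
qed

text \<open>A cycle on \<open>n\<close> vertices fits into neither part, so it leaves
  \<open>A\<close> and returns. Both steps must use the same edge in opposite directions, which is
  impossible for \<open>n \<ge> 3\<close>. The form \<open>R b' a'\<close> in \<open>one\<close>
  matches the direction of the return step.\<close>

lemma no_cycle_two_parts:
  assumes n: "3 \<le> n" and fin: "finite A" "finite B" and card: "card A < n" "card B < n"
    and AB: "A \<inter> B = {}"
    and one: "\<And>a b a' b'. a \<in> A \<Longrightarrow> b \<in> B \<Longrightarrow> a' \<in> A \<Longrightarrow> b' \<in> B \<Longrightarrow> R a b \<Longrightarrow> R b' a' \<Longrightarrow> a = a' \<and> b = b'"
  shows "\<not> has_cycle R (A \<union> B) n"
proof
  assume "has_cycle R (A \<union> B) n"
  then obtain xs where xs: "cycle_list R xs" "length xs = n" "set xs \<subseteq> A \<union> B"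
    by (auto simp: has_cycle_def)
  have d: "distinct xs" and edge: "\<And>i. i < n \<Longrightarrow> R (xs ! i) (xs ! (Suc i mod n))"
    using xs by (auto simp: cycle_list_conv_nth)
  have card_xs: "card (set xs) = n" using xs d by (simp add: distinct_card)
  have "\<not> set xs \<subseteq> A" "\<not> set xs \<subseteq> B" using card fin card_mono card_xs by (metis leD)+
  then obtain x y where x: "x \<in> set xs" "x \<in> A" and y: "y \<in> set xs" "y \<notin> A" using xs(3) by blast
  obtain i where i: "i < n" "xs ! i \<in> A" "xs ! (Suc i mod n) \<notin> A"
    using cycle_list_crossing[OF xs(1) x(1), of "\<lambda>v. v \<in> A" y] x y xs(2) by auto
  obtain j where j: "j < n" "xs ! j \<notin> A" "xs ! (Suc j mod n) \<in> A"
    using cycle_list_crossing[OF xs(1) y(1), of "\<lambda>v. v \<notin> A" x] x y xs(2) by auto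
  have mod: "Suc i mod n < n" "Suc j mod n < n" using n by auto
  have inAB: "xs ! l \<in> A \<union> B" if "l < n" for l using xs that nth_mem by blast
  have "xs ! i = xs ! (Suc j mod n) \<and> xs ! (Suc i mod n) = xs ! j"
    using one[OF i(2) _ j(3), of "xs ! (Suc i mod n)" "xs ! j"] inAB[OF mod(1)] inAB[OF j(1)] i j edge
    by auto
  then have "i = Suc j mod n" "Suc i mod n = j"
    using d i(1) j(1) mod xs(2) by (auto simp: nth_eq_iff_index_eq)
  then show False using i j n by (auto simp: mod_Suc split: if_splits)
qed

lemma no_odd_cycle_bipartite:
  assumes k: "k \<in> {3, 5}" and bip: "\<And>x y. x \<in> V \<Longrightarrow> y \<in> V \<Longrightarrow> x \<noteq> y \<Longrightarrow> E x y \<Longrightarrow> (P x \<longleftrightarrow> \<not> P y)"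
  shows "\<not> has_cycle E V k"
proof
  assume "has_cycle E V k"
  then obtain xs where xs: "cycle_list E xs" "length xs = k" "set xs \<subseteq> V" by (auto simp: has_cycle_def)
  show False
  proof (cases "k = 3")
    case True
    then obtain a b c where "xs = [a, b, c]"
      using xs(2) by (auto simp: numeral_eq_Suc length_Suc_conv)
    then show False using xs bip[of a b] bip[of b c] bip[of c a] by (auto simp: cycle_list_def)
  next
    case False
    then have "length xs = 5" using k xs(2) by simp
    then obtain a b c d e where "xs = [a, b, c, d, e]"
      by (auto simp: numeral_eq_Suc length_Suc_conv)
    then show False using xs bip[of a b] bip[of b c] bip[of c d] bip[of d e] bip[of e a]
      by (auto simp: cycle_list_def)
  qed
qed

section \<open>Red-blue graphs\<close>

text \<open>Turns a colouring of sets into a symmetric relation. Its diagonal depends on the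
  arbitrary colours of singletons, which no cycle of length at least 2 sees.\<close>

definition coloured :: "colour \<Rightarrow> 'a rb_graph \<Rightarrow> 'a \<Rightarrow> 'a \<Rightarrow> bool" where
  "coloured c G x y \<longleftrightarrow> colouring G {x, y} = c"

lemma symp_coloured: "symp (coloured c G)"
  by (auto simp: symp_def coloured_def insert_commute)

lemma not_coloured_Red: "(\<lambda>x y. \<not> coloured Red G x y) = coloured Blue G"
  by (auto simp: coloured_def fun_eq_iff intro: colour.exhaust)

text \<open>An embedding \<open>f\<close> of the cycle graph corresponds to the list
  \<open>map f [0..<k]\<close>, and a list \<open>xs\<close> to the embedding
  \<open>(!) xs\<close>.\<close>

lemma contains_cycle_graph_iff:
  assumes k: "3 \<le> k"
  shows "contains_graph (colour_subgraph c G) (cycle_graph k) \<longleftrightarrow>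
    has_cycle (coloured c G) (rb_verts G) k"
proof
  assume "contains_graph (colour_subgraph c G) (cycle_graph k)"
  then obtain f where f: "inj_on f {..<k}" "f ` {..<k} \<subseteq> rb_verts G"
    and img: "(`) f ` edges (cycle_graph k) \<subseteq> edges (colour_subgraph c G)"
    by (auto simp: contains_graph_def cycle_graph_def colour_subgraph_def)
  have "colouring G {f i, f (Suc i mod k)} = c" if "i < k" for i
  proof -
    have "{i, Suc i mod k} \<in> edges (cycle_graph k)" using that by (auto simp: cycle_graph_def)
    then have "f ` {i, Suc i mod k} \<in> edges (colour_subgraph c G)" using img by blast
    then show ?thesis by (simp add: colour_subgraph_def)
  qed
  then have "cycle_list (coloured c G) (map f [0..<k])"
    using k f by (auto simp: cycle_list_conv_nth distinct_map coloured_def atLeast0LessThan)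
  then show "has_cycle (coloured c G) (rb_verts G) k"
    by (rule has_cycleI) (use f in auto)
next
  assume "has_cycle (coloured c G) (rb_verts G) k"
  then obtain xs where xs: "cycle_list (coloured c G) xs" "length xs = k" "set xs \<subseteq> rb_verts G"
    by (auto simp: has_cycle_def)
  have d: "distinct xs" and e: "\<And>i. i < k \<Longrightarrow> colouring G {xs ! i, xs ! (Suc i mod k)} = c"
    using xs by (auto simp: cycle_list_conv_nth coloured_def)
  \<comment> \<open>Edges of a colour subgraph are two-element sets, so consecutive vertices have to
    differ.\<close>
  have ne: "xs ! i \<noteq> xs ! (Suc i mod k)" if "i < k" for i
    using d xs(2) that k by (subst nth_eq_iff_index_eq) (auto simp: mod_Suc)
  have V: "xs ! i \<in> rb_verts G" if "i < k" for i using xs that nth_mem by blast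
  have "inj_on ((!) xs) {..<k}" using d xs(2) by (auto simp: inj_on_def nth_eq_iff_index_eq)
  moreover have "(!) xs ` {..<k} \<subseteq> rb_verts G" using V by auto
  moreover have "(\<lambda>e. (!) xs ` e) ` edges (cycle_graph k) \<subseteq> edges (colour_subgraph c G)"
    using V e ne k by (auto simp: cycle_graph_def colour_subgraph_def)
  ultimately show "contains_graph (colour_subgraph c G) (cycle_graph k)"
    by (auto simp: contains_graph_def cycle_graph_def colour_subgraph_def)
qed

lemma cycle_ramsey_number_eq:
  assumes k: "k \<in> {3, 5}" "k < n"
  shows "cycle_ramsey_number n k = 2 * n - 1"
  unfolding cycle_ramsey_number_def
proof (rule Least_equality)
  have k3: "3 \<le> k" "3 \<le> n" using k by auto
  show "0 < 2 * n - 1 \<and> (\<forall>G :: nat rb_graph. red_blue_graph G \<and> card (rb_verts G) = 2 * n - 1 \<longrightarrow>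
      contains_graph (red_subgraph G) (cycle_graph n) \<or>
      contains_graph (blue_subgraph G) (cycle_graph k))"
  proof (intro conjI allI impI)
    fix G :: "nat rb_graph" assume "red_blue_graph G \<and> card (rb_verts G) = 2 * n - 1"
    then show "contains_graph (red_subgraph G) (cycle_graph n) \<or>
        contains_graph (blue_subgraph G) (cycle_graph k)"
      using has_cycle_of_order[OF k symp_coloured, of "rb_verts G" Red G] k3
      by (auto simp: contains_cycle_graph_iff red_blue_graph_def not_coloured_Red)
  qed (use k3 in simp)
next
  have k3: "3 \<le> k" "3 \<le> n" using k by auto
  fix N assume N: "0 < N \<and> (\<forall>G :: nat rb_graph. red_blue_graph G \<and> card (rb_verts G) = N \<longrightarrow>
      contains_graph (red_subgraph G) (cycle_graph n) \<or>
      contains_graph (blue_subgraph G) (cycle_graph k))"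
  show "2 * n - 1 \<le> N"
  proof (rule ccontr)
    assume less: "\<not> ?thesis"
    \<comment> \<open>Two red cliques on at most \<open>n - 1\<close> vertices each, with all edges
      between them blue. Minimality concerns every \<open>N \<le> 2 * n - 2\<close>, so the cliques
      may be smaller and the second one empty.\<close>
    define G where "G = \<lparr>rb_verts = {..<N},
      colouring = (\<lambda>e. if e \<subseteq> {..<n - 1} \<or> e \<inter> {..<n - 1} = {} then Red else Blue)\<rparr>"
    let ?A = "{..<N} \<inter> {..<n - 1}" and ?B = "{..<N} - {..<n - 1}"
    have "card ?A \<le> card {..<n - 1}" by (intro card_mono) auto
    moreover have "card ?B \<le> card {n - 1..<2 * n - 2}" using less by (intro card_mono) auto
    ultimately have "card ?A < n" "card ?B < n" using k3 by auto
    then have "\<not> has_cycle (coloured Red G) (?A \<union> ?B) n"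
      using k3 by (intro no_cycle_two_parts) (auto simp: coloured_def G_def)
    moreover have "?A \<union> ?B = rb_verts G" by (auto simp: G_def)
    moreover have "\<not> has_cycle (coloured Blue G) (rb_verts G) k"
      by (rule no_odd_cycle_bipartite[OF k(1), where P = "\<lambda>x. x < n - 1"])
        (auto simp: coloured_def G_def split: if_splits)
    moreover have "red_blue_graph G" "card (rb_verts G) = N"
      by (auto simp: red_blue_graph_def G_def)
    ultimately show False using N k3 by (auto simp: contains_cycle_graph_iff)
  qed
qed

section \<open>Critical colourings and their blue subgraphs\<close>

lemma cycle_critical_iff:
  assumes k: "k \<in> {3, 5}" "k < n" and G: "red_blue_graph G"
  shows "cycle_critical n k G \<longleftrightarrow>
    (\<exists>A B. rb_verts G = A \<union> B \<and> A \<inter> B = {} \<and> card A = n - 1 \<and> card B = n - 1 \<and>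
       two_cliques (coloured Red G) A B)" (is "_ \<longleftrightarrow> ?R")
proof -
  have k3: "3 \<le> k" "3 \<le> n" using k by auto
  have fin: "finite (rb_verts G)" using G by (simp add: red_blue_graph_def)
  have crit: "cycle_critical n k G \<longleftrightarrow> card (rb_verts G) = 2 * (n - 1) \<and>
      \<not> has_cycle (coloured Red G) (rb_verts G) n \<and> \<not> has_cycle (coloured Blue G) (rb_verts G) k"
    using G k3 by (auto simp: cycle_critical_def contains_cycle_graph_iff cycle_ramsey_number_eq[OF k])
  show ?thesis
  proof
    assume "cycle_critical n k G"
    then have c: "card (rb_verts G) = 2 * (n - 1)" "\<not> has_cycle (coloured Red G) (rb_verts G) n"
      "\<not> has_cycle (\<lambda>x y. \<not> coloured Red G x y) (rb_verts G) k"
      by (auto simp: crit not_coloured_Red)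
    show ?R by (rule two_cliques_of_critical[OF k symp_coloured fin c]) blast
  next
    assume ?R
    then obtain A B where AB: "rb_verts G = A \<union> B" "A \<inter> B = {}" "card A = n - 1" "card B = n - 1"
      and tc: "two_cliques (coloured Red G) A B" by blast
    have finAB: "finite A" "finite B" using AB fin by auto
    have "card (rb_verts G) = 2 * (n - 1)" using AB finAB by (simp add: card_Un_disjoint)
    moreover have "\<not> has_cycle (coloured Red G) (A \<union> B) n"
    proof (rule no_cycle_two_parts[OF k3(2) finAB _ _ AB(2)])
      fix a b a' b' assume h: "a \<in> A" "b \<in> B" "a' \<in> A" "b' \<in> B" "coloured Red G a b" "coloured Red G b' a'"
      then have "coloured Red G a' b'" using symp_coloured[of Red G] by (auto dest: sympD)
      then show "a = a' \<and> b = b'" using tc h unfolding two_cliques_def by blast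
    qed (use AB k3 in auto)
    moreover have "\<not> has_cycle (coloured Blue G) (A \<union> B) k"
    proof (rule no_odd_cycle_bipartite[OF k(1), where P = "\<lambda>x. x \<in> A"])
      fix x y assume h: "x \<in> A \<union> B" "y \<in> A \<union> B" "x \<noteq> y" "coloured Blue G x y"
      then have "\<not> coloured Red G x y" by (simp add: coloured_def)
      then show "x \<in> A \<longleftrightarrow> y \<notin> A" using tc h AB(2) unfolding two_cliques_def clique_in_def by blast
    qed
    ultimately show "cycle_critical n k G" using crit AB(1) by simp
  qed
qed

text \<open>Bounding \<open>edges H\<close> from both sides treats the complete bipartite graph and
  the one with an edge deleted at once. The cliques are the preimages of the two sides under the
  isomorphism.\<close>

lemma two_cliques_of_graph_iso:
  assumes iso: "graph_iso (blue_subgraph G) H" and vH: "verts H = verts (complete_bipartite m m)"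
    and eH: "edges H \<subseteq> edges (complete_bipartite m m)"
      "edges (complete_bipartite m m) \<subseteq> insert e (edges H)"
  shows "\<exists>A B. rb_verts G = A \<union> B \<and> A \<inter> B = {} \<and> card A = m \<and> card B = m \<and>
    two_cliques (coloured Red G) A B"
proof -
  let ?K = "complete_bipartite m m" and ?V = "rb_verts G"
  obtain f where f: "bij_betw f ?V ({..<m} <+> {..<m})"
    and fe: "edges H = (`) f ` edges (blue_subgraph G)"
    using iso vH by (auto simp: graph_iso_def colour_subgraph_def complete_bipartite_def)
  have inj: "inj_on f ?V" and img: "f ` ?V = {..<m} <+> {..<m}" using f by (auto simp: bij_betw_def)
  have red: "coloured Red G x y \<longleftrightarrow> {f x, f y} \<notin> edges H" if "x \<in> ?V" "y \<in> ?V" "x \<noteq> y" for x y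
  proof -
    have "{f x, f y} \<in> edges H \<longleftrightarrow> {x, y} \<in> edges (blue_subgraph G)"
    proof
      assume "{f x, f y} \<in> edges H"
      then obtain d where d: "f ` {x, y} = f ` d" "d \<in> edges (blue_subgraph G)" using fe by auto
      then have "d \<subseteq> ?V" by (auto simp: colour_subgraph_def nsets_def)
      then have "{x, y} = d" using d(1) that inj by (subst (asm) inj_on_image_eq_iff) auto
      then show "{x, y} \<in> edges (blue_subgraph G)" using d by simp
    next
      assume "{x, y} \<in> edges (blue_subgraph G)"
      then have "f ` {x, y} \<in> edges H" unfolding fe by (rule imageI)
      then show "{f x, f y} \<in> edges H" by simp
    qed
    also have "\<dots> \<longleftrightarrow> colouring G {x, y} = Blue" using that by (simp add: colour_subgraph_def)
    finally show ?thesis by (cases "colouring G {x, y}") (auto simp: coloured_def)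
  qed
  define A where "A = {v \<in> ?V. f v \<in> Inl ` {..<m}}"
  define B where "B = {v \<in> ?V. f v \<in> Inr ` {..<m}}"
  have "f v \<in> Inl ` {..<m} \<union> Inr ` {..<m}" if "v \<in> ?V" for v
    using imageI[OF that, of f] unfolding img Plus_def .
  then have "?V = A \<union> B" unfolding A_def B_def by blast
  moreover have "A \<inter> B = {}" by (auto simp: A_def B_def)
  ultimately have AB: "?V = A \<union> B" "A \<inter> B = {}" .
  have "f ` A = f ` ?V \<inter> Inl ` {..<m}" "f ` B = f ` ?V \<inter> Inr ` {..<m}"
    unfolding A_def B_def by blast+
  then have "f ` A = Inl ` {..<m}" "f ` B = Inr ` {..<m}"
    unfolding img Plus_def by auto
  moreover have "inj_on f A" "inj_on f B" using inj by (auto simp: A_def B_def inj_on_def)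
  ultimately have cards: "card A = m" "card B = m"
    by (metis card_image card_lessThan inj_Inl inj_Inr inj_on_subset subset_UNIV)+
  have nonedge: "{Inl i, Inl j} \<notin> edges H" "{Inr i, Inr j} \<notin> edges H" for i j
    using eH(1) by (auto simp: complete_bipartite_def doubleton_eq_iff)
  have "clique_in (coloured Red G) A" "clique_in (coloured Red G) B"
    using red nonedge unfolding clique_in_def A_def B_def by auto
  moreover have "a = a' \<and> b = b'"
    if h: "a \<in> A" "b \<in> B" "a' \<in> A" "b' \<in> B" "coloured Red G a b" "coloured Red G a' b'" for a b a' b'
  proof -
    have hV: "a \<in> ?V" "b \<in> ?V" "a' \<in> ?V" "b' \<in> ?V" "a \<noteq> b" "a' \<noteq> b'" using h AB by auto
    have "{f u, f v} \<in> edges ?K" if "u \<in> A" "v \<in> B" for u v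
    proof -
      obtain i j where "f u = Inl i" "i < m" "f v = Inr j" "j < m"
        using \<open>u \<in> A\<close> \<open>v \<in> B\<close> unfolding A_def B_def by auto
      then show ?thesis unfolding complete_bipartite_def by auto
    qed
    then have "{f a, f b} \<in> edges ?K" "{f a', f b'} \<in> edges ?K" using h by blast+
    \<comment> \<open>A red edge between \<open>A\<close> and \<open>B\<close> is sent to an edge of
      \<open>?K\<close> missing from \<open>H\<close>, and only \<open>e\<close> can be
      missing.\<close>
    then have "{f a, f b} = e" "{f a', f b'} = e" using red[of a b] red[of a' b'] hV h eH(2) by auto
    then have "{f a, f b} = {f a', f b'}" by simp
    then have "f a = f a'" "f b = f b'" using h by (auto simp: A_def B_def doubleton_eq_iff)
    then show ?thesis using inj hV by (auto dest: inj_onD)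
  qed
  ultimately have "two_cliques (coloured Red G) A B" unfolding two_cliques_def by blast
  then show ?thesis using AB cards by blast
qed

text \<open>Numbering the two parts by \<open>g\<close> and \<open>h\<close> gives the isomorphism;
  the deleted edge is the image of the red edge between the parts, if there is one.\<close>

lemma graph_iso_of_two_cliques:
  assumes V: "rb_verts G = A \<union> B" "A \<inter> B = {}" "finite A" "finite B" "card A = m" "card B = m"
    and tc: "two_cliques (coloured Red G) A B"
  shows "graph_iso (blue_subgraph G) (complete_bipartite m m) \<or>
    (\<exists>e \<in> edges (complete_bipartite m m).
       graph_iso (blue_subgraph G) (delete_edge (complete_bipartite m m) e))"
proof -
  let ?K = "complete_bipartite m m"
  obtain g where g: "bij_betw g A {..<m}" using V by (metis ex_bij_betw_finite_nat atLeast0LessThan)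
  obtain h where h: "bij_betw h B {..<m}" using V by (metis ex_bij_betw_finite_nat atLeast0LessThan)
  define f where "f v = (if v \<in> A then Inl (g v) else Inr (h v))" for v
  have fA: "f a = Inl (g a)" if "a \<in> A" for a using that by (simp add: f_def)
  have fB: "f b = Inr (h b)" if "b \<in> B" for b using that V(2) by (auto simp: f_def)
  have gi: "inj_on g A" "g ` A = {..<m}" and hi: "inj_on h B" "h ` B = {..<m}"
    using g h by (auto simp: bij_betw_def)
  have "inj_on f (A \<union> B)"
  proof (rule inj_onI)
    fix x y assume "x \<in> A \<union> B" "y \<in> A \<union> B" "f x = f y"
    then show "x = y"
      using inj_onD[OF gi(1), of x y] inj_onD[OF hi(1), of x y] by (auto simp: f_def split: if_splits)
  qed
  moreover have "f ` (A \<union> B) = {..<m} <+> {..<m}"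
  proof -
    have "f ` A = Inl ` g ` A" "f ` B = Inr ` h ` B"
      unfolding image_image by (rule image_cong; simp add: fA fB)+
    then show ?thesis using gi hi by (simp add: image_Un Plus_def)
  qed
  ultimately have bij: "bij_betw f (verts (blue_subgraph G)) (verts ?K)"
    by (simp add: bij_betw_def V(1) colour_subgraph_def complete_bipartite_def)
  have blue: "edges (blue_subgraph G) = {{a, b} | a b. a \<in> A \<and> b \<in> B \<and> \<not> coloured Red G a b}"
    (is "?E = ?F")
  proof
    show "?E \<subseteq> ?F"
    proof
      fix d assume "d \<in> ?E"
      then obtain x y where d: "d = {x, y}" "x \<in> A \<union> B" "y \<in> A \<union> B" "x \<noteq> y" "colouring G {x, y} = Blue"
        by (auto simp: colour_subgraph_def V(1) elim!: nsets2_E)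
      then have n: "\<not> coloured Red G x y" "\<not> coloured Red G y x"
        by (auto simp: coloured_def insert_commute)
      then have "x \<in> A \<and> y \<in> B \<or> x \<in> B \<and> y \<in> A"
        using tc d unfolding two_cliques_def clique_in_def by blast
      then show "d \<in> ?F" using d(1) n by (auto simp: insert_commute)
    qed
    show "?F \<subseteq> ?E"
    proof
      fix d assume "d \<in> ?F"
      then obtain a b where d: "d = {a, b}" "a \<in> A" "b \<in> B" "\<not> coloured Red G a b" by blast
      moreover have "a \<noteq> b" using d V(2) by auto
      ultimately show "d \<in> ?E"
        using V(1) by (cases "colouring G {a, b}") (auto simp: colour_subgraph_def coloured_def)
    qed
  qed
  have img: "(`) f ` edges (blue_subgraph G) =
      {{Inl (g a), Inr (h b)} | a b. a \<in> A \<and> b \<in> B \<and> \<not> coloured Red G a b}"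
  proof -
    have f2: "f ` {a, b} = {Inl (g a), Inr (h b)}" if "a \<in> A" "b \<in> B" for a b using that fA fB by simp
    show ?thesis (is "?L = ?M")
    proof
      show "?L \<subseteq> ?M" unfolding blue using f2 by blast
      show "?M \<subseteq> ?L"
      proof
        fix d assume "d \<in> ?M"
        then obtain a b where "d = f ` {a, b}" "{a, b} \<in> ?F" using f2 by blast
        then show "d \<in> ?L" unfolding blue by blast
      qed
    qed
  qed
  have K: "edges ?K = {{Inl (g a), Inr (h b)} | a b. a \<in> A \<and> b \<in> B}"
  proof -
    have "edges ?K = {{Inl i, Inr j} | i j. i \<in> g ` A \<and> j \<in> h ` B}"
      unfolding gi(2) hi(2) by (simp add: complete_bipartite_def)
    then show ?thesis by blast
  qed
  show ?thesis
  proof (cases "\<exists>a\<in>A. \<exists>b\<in>B. coloured Red G a b")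
    case False
    then have "edges ?K = (`) f ` edges (blue_subgraph G)" unfolding img K by blast
    then show ?thesis using bij unfolding graph_iso_def by blast
  next
    case True
    then obtain a b where ab: "a \<in> A" "b \<in> B" "coloured Red G a b" by blast
    let ?e = "{Inl (g a), Inr (h b)}"
    have e: "?e \<in> edges ?K" using ab unfolding K by blast
    \<comment> \<open>By injectivity of \<open>g\<close> and \<open>h\<close> and uniqueness of the
      red cross edge, deleting \<open>?e\<close> removes the image of the red pair and nothing
      else.\<close>
    have same: "?e = {Inl (g a'), Inr (h b')} \<longleftrightarrow> coloured Red G a' b'" if "a' \<in> A" "b' \<in> B" for a' b'
    proof
      assume "?e = {Inl (g a'), Inr (h b')}"
      then have "g a = g a'" "h b = h b'" by (auto simp: doubleton_eq_iff)
      then have "a = a'" "b = b'" using gi(1) hi(1) ab that by (auto dest: inj_onD)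
      then show "coloured Red G a' b'" using ab by simp
    next
      assume "coloured Red G a' b'"
      then have "a = a' \<and> b = b'" using tc ab that unfolding two_cliques_def by blast
      then show "?e = {Inl (g a'), Inr (h b')}" by simp
    qed
    have "edges (delete_edge ?K ?e) = (`) f ` edges (blue_subgraph G)"
    proof -
      have "edges ?K - {?e} = {{Inl (g a'), Inr (h b')} | a' b'. a' \<in> A \<and> b' \<in> B \<and> \<not> coloured Red G a' b'}"
        (is "?L = ?M")
      proof
        show "?L \<subseteq> ?M"
        proof
          fix d assume d: "d \<in> ?L"
          then obtain a' b' where h: "d = {Inl (g a'), Inr (h b')}" "a' \<in> A" "b' \<in> B"
            unfolding K by blast
          then have "\<not> coloured Red G a' b'" using same[of a' b'] d by auto
          then show "d \<in> ?M" using h by blast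
        qed
        show "?M \<subseteq> ?L"
        proof
          fix d assume "d \<in> ?M"
          then obtain a' b' where h: "d = {Inl (g a'), Inr (h b')}" "a' \<in> A" "b' \<in> B"
            "\<not> coloured Red G a' b'" by blast
          then have "d \<noteq> ?e" using same[of a' b'] by auto
          then show "d \<in> ?L" using h unfolding K by blast
        qed
      qed
      then show ?thesis unfolding img by (simp add: delete_edge_def)
    qed
    moreover have "verts (delete_edge ?K ?e) = verts ?K" by (simp add: delete_edge_def)
    ultimately show ?thesis using bij e unfolding graph_iso_def by metis
  qed
qed

lemma cycle_critical_iff_graph_iso:
  assumes k: "k \<in> {3, 5}" "k < n" and G: "red_blue_graph G"
  shows "cycle_critical n k G \<longleftrightarrow>
    graph_iso (blue_subgraph G) (complete_bipartite (n - 1) (n - 1)) \<or>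
    (\<exists>e \<in> edges (complete_bipartite (n - 1) (n - 1)).
       graph_iso (blue_subgraph G) (delete_edge (complete_bipartite (n - 1) (n - 1)) e))"
    (is "_ \<longleftrightarrow> ?R")
proof
  assume "cycle_critical n k G"
  then obtain A B where AB: "rb_verts G = A \<union> B" "A \<inter> B = {}" "card A = n - 1" "card B = n - 1"
    "two_cliques (coloured Red G) A B" using cycle_critical_iff[OF assms] by blast
  then have "finite A" "finite B" using G by (auto simp: red_blue_graph_def)
  then show ?R using graph_iso_of_two_cliques AB by blast
next
  let ?K = "complete_bipartite (n - 1) (n - 1)"
  assume ?R
  then obtain H e where "graph_iso (blue_subgraph G) H" "verts H = verts ?K"
    "edges H \<subseteq> edges ?K" "edges ?K \<subseteq> insert e (edges H)"
  proof
    assume "graph_iso (blue_subgraph G) ?K"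
    \<comment> \<open>If no edge is deleted, any \<open>e\<close> will do.\<close>
    then show thesis using that[of ?K] by blast
  next
    assume "\<exists>e\<in>edges ?K. graph_iso (blue_subgraph G) (delete_edge ?K e)"
    then obtain e where "graph_iso (blue_subgraph G) (delete_edge ?K e)" by blast
    then show thesis using that[of "delete_edge ?K e" e] by (auto simp: delete_edge_def)
  qed
  then show "cycle_critical n k G"
    unfolding cycle_critical_iff[OF assms] by (rule two_cliques_of_graph_iso)
qed

theorem corollary1p14:
  fixes G :: "'a rb_graph" and n :: nat
  assumes "red_blue_graph G"
  shows "(5 \<le> n \<longrightarrow>
            (cycle_critical n 3 G \<longleftrightarrow>
               graph_iso (blue_subgraph G) (complete_bipartite (n - 1) (n - 1)) \<or>
               (\<exists>e \<in> edges (complete_bipartite (n - 1) (n - 1)).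
                  graph_iso (blue_subgraph G)
                    (delete_edge (complete_bipartite (n - 1) (n - 1)) e)))) \<and>
         (6 \<le> n \<longrightarrow>
            (cycle_critical n 5 G \<longleftrightarrow>
               graph_iso (blue_subgraph G) (complete_bipartite (n - 1) (n - 1)) \<or>
               (\<exists>e \<in> edges (complete_bipartite (n - 1) (n - 1)).
                  graph_iso (blue_subgraph G)
                    (delete_edge (complete_bipartite (n - 1) (n - 1)) e))))"
  using cycle_critical_iff_graph_iso[of 3 n G] cycle_critical_iff_graph_iso[of 5 n G] assms by auto

end
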